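(* Let $D$ be a ring, $\sigma\in\mathrm{Aut}(D)$, let $L=D[x^{\pm1};\sigma]$ be the skew Laurent polynomial ring and let $V$ be a simple $D$-module. Then: (1) The $L$-module $L\otimes_DV$ is a Euclidean module with Euclidean function $l$ (the length function). (2) Every submodule of the $L$-module $L\otimes_DV$ is principal (generated by one element). (3) If $N$ is a nonzero submodule of $L\otimes_DV$, then every element of the non-empty set $\mathcal{G}(N):=\{n\in N: n\neq0,\ l(n)=l_0\}$, where $l_0:=\min\{l(n'):0\neq n'\in N\}$, generates the $L$-module $N$, and $\mathcal{G}(N)\subseteq\mathcal{UA}(L\otimes_DV)$.
   Context: Rings are unital and modules are left modules. $L=D[x^{\pm1};\sigma]=\bigoplus_{i\in\mathbb{Z}}Dx^i$ with $xa=\sigma(a)x$ for $a\in D$. The induced module is $L\otimes_DV=\bigoplus_{i\in\mathbb{Z}}x^i\otimes V$, $\mathbb{Z}$-graded over the $\mathbb{Z}$-graded ring $L$ (with $L_i=Dx^i$, $L_0=D$). Each nonzero $v\in L\otimes_DV$ is uniquely $v=\sum_{i=m}^nx^i\otimes v_i$ with $v_i\in V$ and $v_m\neq0\neq v_n$; its length is $l(v):=n-m\in\mathbb{N}$. An $L$-module $M$ is Euclidean with Euclidean function $d:M\setminus\{0\}\to\mathbb{N}$ if for any nonzero $u,v\in M$ there are $q\in L$, $r\in M$ with $u=qv+r$ and either $r=0$ or $d(r)<d(v)$. For a $\mathbb{Z}$-graded ring $A=\bigoplus A_i$ and a $\mathbb{Z}$-graded module $M=\bigoplus M_i$, an element $m=\sum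 m_i$ ($m_i\in M_i$) is a uni-annihilator element if $\mathrm{ann}_{A_0}(m)=\mathrm{ann}_{A_0}(m_i)$ (left annihilators in $A_0$) for all nonzero components $m_i$; $\mathcal{UA}(M)$ is the set of uni-annihilator elements. *)

theory Defs
  imports "HOL-Algebra.Module" "HOL-Algebra.QuotRing" "HOL-Algebra.Free_Abelian_Groups"
begin

section \<open>Left modules over noncommutative rings\<close>

text \<open>The library locale \<open>module\<close> requires a commutative ring of scalars.  The record \<open>module\<close> and the
  locale \<open>submodule\<close> do not, so only the former is replaced.  The fields \<open>mult\<close> and \<open>one\<close> that the
  record \<open>module\<close> inherits from \<open>ring\<close> play no role.\<close>

locale left_module = R?: ring R + M?: abelian_group M
  for R :: "('a, 'm) ring_scheme" (structure)
    and M :: "('a, 'b, 'n) module_scheme" (structure) +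
  assumes smult_closed:
      "\<lbrakk>a \<in> carrier R; u \<in> carrier M\<rbrakk> \<Longrightarrow> a \<odot>\<^bsub>M\<^esub> u \<in> carrier M"
    and smult_l_distr:
      "\<lbrakk>a \<in> carrier R; b \<in> carrier R; u \<in> carrier M\<rbrakk> \<Longrightarrow>
        (a \<oplus>\<^bsub>R\<^esub> b) \<odot>\<^bsub>M\<^esub> u = a \<odot>\<^bsub>M\<^esub> u \<oplus>\<^bsub>M\<^esub> b \<odot>\<^bsub>M\<^esub> u"
    and smult_r_distr:
      "\<lbrakk>a \<in> carrier R; u \<in> carrier M; v \<in> carrier M\<rbrakk> \<Longrightarrow>
        a \<odot>\<^bsub>M\<^esub> (u \<oplus>\<^bsub>M\<^esub> v) = a \<odot>\<^bsub>M\<^esub> u \<oplus>\<^bsub>M\<^esub> a \<odot>\<^bsub>M\<^esub> v"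
    and smult_assoc:
      "\<lbrakk>a \<in> carrier R; b \<in> carrier R; u \<in> carrier M\<rbrakk> \<Longrightarrow>
        (a \<otimes>\<^bsub>R\<^esub> b) \<odot>\<^bsub>M\<^esub> u = a \<odot>\<^bsub>M\<^esub> (b \<odot>\<^bsub>M\<^esub> u)"
    and smult_one:
      "u \<in> carrier M \<Longrightarrow> \<one>\<^bsub>R\<^esub> \<odot>\<^bsub>M\<^esub> u = u"

locale simple_module = left_module R M
  for R :: "('a, 'm) ring_scheme" (structure)
    and M :: "('a, 'b, 'n) module_scheme" (structure) +
  assumes nonzero: "carrier M \<noteq> {\<zero>\<^bsub>M\<^esub>}"
    and submodule_trivial: "submodule N R M \<Longrightarrow> N = {\<zero>\<^bsub>M\<^esub>} \<or> N = carrier M"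

definition generates_submodule ::
    "('a, 'm) ring_scheme \<Rightarrow> ('a, 'b, 'n) module_scheme \<Rightarrow> 'b \<Rightarrow> 'b set \<Rightarrow> bool" where
  "generates_submodule R M u N \<longleftrightarrow> u \<in> carrier M \<and> \<Inter>{H. submodule H R M \<and> u \<in> H} = N"

definition principal_submodule ::
    "('a, 'm) ring_scheme \<Rightarrow> ('a, 'b, 'n) module_scheme \<Rightarrow> 'b set \<Rightarrow> bool" where
  "principal_submodule R M N \<longleftrightarrow> (\<exists>u. generates_submodule R M u N)"

locale euclidean_module = left_module R M
  for R :: "('a, 'm) ring_scheme" (structure)
    and M :: "('a, 'b, 'n) module_scheme" (structure) +
  fixes d :: "'b \<Rightarrow> nat"
  assumes division:
    "\<lbrakk>u \<in> carrier M - {\<zero>\<^bsub>M\<^esub>}; v \<in> carrier M - {\<zero>\<^bsub>M\<^esub>}\<rbrakk> \<Longrightarrow>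
      \<exists>q \<in> carrier R. \<exists>r \<in> carrier M. u = q \<odot>\<^bsub>M\<^esub> v \<oplus>\<^bsub>M\<^esub> r \<and> (r = \<zero>\<^bsub>M\<^esub> \<or> d r < d v)"


section \<open>Graded modules and uni-annihilator elements\<close>

text \<open>A grading is given by its family of homogeneous parts, indexed by the integers.  The
  components below are meaningful when \<open>M\<close> is the direct sum of the parts \<open>gM i\<close>.\<close>

definition homogeneous_component ::
    "('a, 'b, 'n) module_scheme \<Rightarrow> (int \<Rightarrow> 'b set) \<Rightarrow> 'b \<Rightarrow> int \<Rightarrow> 'b" where
  "homogeneous_component M gM u =
    (THE c. (\<forall>i. c i \<in> gM i) \<and> finite {i. c i \<noteq> \<zero>\<^bsub>M\<^esub>} \<and>
            u = (\<Oplus>\<^bsub>M\<^esub>i \<in> {i. c i \<noteq> \<zero>\<^bsub>M\<^esub>}. c i))"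

definition annihilator_in :: "'a set \<Rightarrow> ('a, 'b, 'n) module_scheme \<Rightarrow> 'b \<Rightarrow> 'a set" where
  "annihilator_in S M u = {a \<in> S. a \<odot>\<^bsub>M\<^esub> u = \<zero>\<^bsub>M\<^esub>}"

definition uni_annihilators ::
    "(int \<Rightarrow> 'a set) \<Rightarrow> ('a, 'b, 'n) module_scheme \<Rightarrow> (int \<Rightarrow> 'b set) \<Rightarrow> 'b set" where
  "uni_annihilators gA M gM =
    {u \<in> carrier M. \<forall>i. homogeneous_component M gM u i \<noteq> \<zero>\<^bsub>M\<^esub> \<longrightarrow>
      annihilator_in (gA 0) M u = annihilator_in (gA 0) M (homogeneous_component M gM u i)}"


section \<open>Skew Laurent polynomial rings\<close>

definition automorphism_power :: "('a, 'm) ring_scheme \<Rightarrow> ('a \<Rightarrow> 'a) \<Rightarrow> int \<Rightarrow> 'a \<Rightarrow> 'a" where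
  "automorphism_power D \<sigma> i =
    (if 0 \<le> i then \<sigma> ^^ nat i else inv_into (carrier D) \<sigma> ^^ nat (- i))"

text \<open>The function \<open>f\<close> stands for the finite sum of the \<open>f i x\<^sup>i\<close>, coefficients on the left, so that
  \<open>(a x\<^sup>i) (b x\<^sup>j) = a \<sigma>\<^sup>i(b) x\<^sup>i\<^sup>+\<^sup>j\<close>.\<close>

definition skew_laurent :: "('a, 'm) ring_scheme \<Rightarrow> ('a \<Rightarrow> 'a) \<Rightarrow> (int \<Rightarrow> 'a) ring" where
  "skew_laurent D \<sigma> =
    \<lparr>carrier = {f. (\<forall>i. f i \<in> carrier D) \<and> finite {i. f i \<noteq> \<zero>\<^bsub>D\<^esub>}},
     monoid.mult = (\<lambda>f g n. \<Oplus>\<^bsub>D\<^esub>i \<in> {i. f i \<noteq> \<zero>\<^bsub>D\<^esub>}. f i \<otimes>\<^bsub>D\<^esub> automorphism_power D \<sigma> i (g (n - i))),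
     one = (\<lambda>i. if i = 0 then \<one>\<^bsub>D\<^esub> else \<zero>\<^bsub>D\<^esub>),
     ring.zero = (\<lambda>i. \<zero>\<^bsub>D\<^esub>),
     ring.add = (\<lambda>f g i. f i \<oplus>\<^bsub>D\<^esub> g i)\<rparr>"

definition laurent_monom :: "('a, 'm) ring_scheme \<Rightarrow> 'a \<Rightarrow> int \<Rightarrow> int \<Rightarrow> 'a" where
  "laurent_monom D a i = (\<lambda>j. if j = i then a else \<zero>\<^bsub>D\<^esub>)"

definition laurent_grading :: "('a, 'm) ring_scheme \<Rightarrow> int \<Rightarrow> (int \<Rightarrow> 'a) set" where
  "laurent_grading D i = {laurent_monom D a i | a. a \<in> carrier D}"


section \<open>Extension of scalars\<close>

text \<open>For a ring homomorphism \<open>\<phi>\<close> from \<open>R\<close> to \<open>S\<close> and a left \<open>R\<close>-module \<open>V\<close>, the tensor product of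
  \<open>S\<close> and \<open>V\<close> over \<open>R\<close> is the free abelian group on the pairs \<open>(s, v)\<close> modulo the usual relations,
  where \<open>S\<close> is a right \<open>R\<close>-module via \<open>\<phi>\<close>.\<close>

definition tensor_relators ::
    "('a, 'm) ring_scheme \<Rightarrow> ('s, 'k) ring_scheme \<Rightarrow> ('a \<Rightarrow> 's) \<Rightarrow> ('a, 'b, 'n) module_scheme
      \<Rightarrow> (('s \<times> 'b) \<Rightarrow>\<^sub>0 int) set" where
  "tensor_relators R S \<phi> V =
     {frag_of (s \<oplus>\<^bsub>S\<^esub> t, v) - frag_of (s, v) - frag_of (t, v) | s t v.
        s \<in> carrier S \<and> t \<in> carrier S \<and> v \<in> carrier V} \<union>
     {frag_of (s, v \<oplus>\<^bsub>V\<^esub> w) - frag_of (s, v) - frag_of (s, w) | s v w.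
        s \<in> carrier S \<and> v \<in> carrier V \<and> w \<in> carrier V} \<union>
     {frag_of (s \<otimes>\<^bsub>S\<^esub> \<phi> a, v) - frag_of (s, a \<odot>\<^bsub>V\<^esub> v) | s a v.
        s \<in> carrier S \<and> a \<in> carrier R \<and> v \<in> carrier V}"

definition tensor_kernel ::
    "('a, 'm) ring_scheme \<Rightarrow> ('s, 'k) ring_scheme \<Rightarrow> ('a \<Rightarrow> 's) \<Rightarrow> ('a, 'b, 'n) module_scheme
      \<Rightarrow> (('s \<times> 'b) \<Rightarrow>\<^sub>0 int) set" where
  "tensor_kernel R S \<phi> V =
     generate (free_Abelian_group (carrier S \<times> carrier V)) (tensor_relators R S \<phi> V)"

definition tensor_coset ::
    "('a, 'm) ring_scheme \<Rightarrow> ('s, 'k) ring_scheme \<Rightarrow> ('a \<Rightarrow> 's) \<Rightarrow> ('a, 'b, 'n) module_scheme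
      \<Rightarrow> (('s \<times> 'b) \<Rightarrow>\<^sub>0 int) \<Rightarrow> (('s \<times> 'b) \<Rightarrow>\<^sub>0 int) set" where
  "tensor_coset R S \<phi> V c =
     tensor_kernel R S \<phi> V #>\<^bsub>free_Abelian_group (carrier S \<times> carrier V)\<^esub> c"

definition pure_tensor ::
    "('a, 'm) ring_scheme \<Rightarrow> ('s, 'k) ring_scheme \<Rightarrow> ('a \<Rightarrow> 's) \<Rightarrow> ('a, 'b, 'n) module_scheme
      \<Rightarrow> 's \<Rightarrow> 'b \<Rightarrow> (('s \<times> 'b) \<Rightarrow>\<^sub>0 int) set" where
  "pure_tensor R S \<phi> V s v = tensor_coset R S \<phi> V (frag_of (s, v))"

text \<open>The scalar multiplication is induced by \<open>s \<cdot> (t \<otimes> v) = st \<otimes> v\<close>; the union ranges over all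
  representatives of the coset \<open>C\<close>, which all yield the same coset.\<close>

definition induced_module ::
    "('a, 'm) ring_scheme \<Rightarrow> ('s, 'k) ring_scheme \<Rightarrow> ('a \<Rightarrow> 's) \<Rightarrow> ('a, 'b, 'n) module_scheme
      \<Rightarrow> ('s, (('s \<times> 'b) \<Rightarrow>\<^sub>0 int) set) module" where
  "induced_module R S \<phi> V =
    (let Q = free_Abelian_group (carrier S \<times> carrier V) Mod tensor_kernel R S \<phi> V in
     \<lparr>carrier = carrier Q,
      monoid.mult = undefined,
      one = undefined,
      ring.zero = \<one>\<^bsub>Q\<^esub>,
      ring.add = (\<otimes>\<^bsub>Q\<^esub>),
      smult = (\<lambda>s C. \<Union>c \<in> C. tensor_coset R S \<phi> V (frag_extend (\<lambda>(t, v). frag_of (s \<otimes>\<^bsub>S\<^esub> t, v)) c))\<rparr>)"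


section \<open>The module induced along a skew Laurent extension\<close>

definition laurent_module ::
    "('a, 'm) ring_scheme \<Rightarrow> ('a \<Rightarrow> 'a) \<Rightarrow> ('a, 'b, 'n) module_scheme
      \<Rightarrow> (int \<Rightarrow> 'a, (((int \<Rightarrow> 'a) \<times> 'b) \<Rightarrow>\<^sub>0 int) set) module" where
  "laurent_module D \<sigma> V = induced_module D (skew_laurent D \<sigma>) (\<lambda>a. laurent_monom D a 0) V"

text \<open>The element \<open>x\<^sup>i \<otimes> v\<close>.\<close>

definition x_tensor ::
    "('a, 'm) ring_scheme \<Rightarrow> ('a \<Rightarrow> 'a) \<Rightarrow> ('a, 'b, 'n) module_scheme \<Rightarrow> int \<Rightarrow> 'b
      \<Rightarrow> (((int \<Rightarrow> 'a) \<times> 'b) \<Rightarrow>\<^sub>0 int) set" where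
  "x_tensor D \<sigma> V i v =
    pure_tensor D (skew_laurent D \<sigma>) (\<lambda>a. laurent_monom D a 0) V (laurent_monom D \<one>\<^bsub>D\<^esub> i) v"

definition laurent_module_grading ::
    "('a, 'm) ring_scheme \<Rightarrow> ('a \<Rightarrow> 'a) \<Rightarrow> ('a, 'b, 'n) module_scheme
      \<Rightarrow> int \<Rightarrow> (((int \<Rightarrow> 'a) \<times> 'b) \<Rightarrow>\<^sub>0 int) set set" where
  "laurent_module_grading D \<sigma> V i = {x_tensor D \<sigma> V i v | v. v \<in> carrier V}"

text \<open>The length of \<open>u \<noteq> 0\<close>; it is not meaningful for the zero element.\<close>

definition laurent_length ::
    "('a, 'm) ring_scheme \<Rightarrow> ('a \<Rightarrow> 'a) \<Rightarrow> ('a, 'b, 'n) module_scheme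
      \<Rightarrow> (((int \<Rightarrow> 'a) \<times> 'b) \<Rightarrow>\<^sub>0 int) set \<Rightarrow> nat" where
  "laurent_length D \<sigma> V u =
    (THE l. \<exists>m n w. m \<le> n \<and> (\<forall>i \<in> {m..n}. w i \<in> carrier V) \<and> w m \<noteq> \<zero>\<^bsub>V\<^esub> \<and> w n \<noteq> \<zero>\<^bsub>V\<^esub> \<and>
       u = (\<Oplus>\<^bsub>laurent_module D \<sigma> V\<^esub>i \<in> {m..n}. x_tensor D \<sigma> V i (w i)) \<and> l = nat (n - m))"

definition minimal_length_elements ::
    "('a, 'm) ring_scheme \<Rightarrow> ('a \<Rightarrow> 'a) \<Rightarrow> ('a, 'b, 'n) module_scheme
      \<Rightarrow> (((int \<Rightarrow> 'a) \<times> 'b) \<Rightarrow>\<^sub>0 int) set set \<Rightarrow> (((int \<Rightarrow> 'a) \<times> 'b) \<Rightarrow>\<^sub>0 int) set set" where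
  "minimal_length_elements D \<sigma> V N =
    {u \<in> N. u \<noteq> \<zero>\<^bsub>laurent_module D \<sigma> V\<^esub> \<and>
       laurent_length D \<sigma> V u =
         (LEAST l. \<exists>u' \<in> N. u' \<noteq> \<zero>\<^bsub>laurent_module D \<sigma> V\<^esub> \<and> l = laurent_length D \<sigma> V u')}"

end

theory Submission
  imports Defs
begin

text \<open>Every element of \<open>L \<otimes>\<^sub>D V\<close> is a finite sum of the \<open>x\<^sup>i \<otimes> v\<^sub>i\<close> with unique coordinates \<open>v\<^sub>i \<in> V\<close>;
  the universal property of the tensor product provides the coordinate maps.  If \<open>l(u) \<ge> l(v)\<close>, then,
  \<open>V\<close> being simple, the leading component of \<open>u\<close> is that of \<open>a x\<^sup>k v\<close> for suitable \<open>a\<close> and \<open>k\<close>, and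
  \<open>u - a x\<^sup>k v\<close> is zero or shorter than \<open>u\<close>.  Division with remainder follows, and with it the
  generation of a submodule by any of its shortest nonzero elements.\<close>

section \<open>Additive maps and left modules\<close>

text \<open>The module is a quotient of a free abelian group by a generated subgroup, so a formal
  sum does not show whether its class is zero; in particular nothing shows directly that
  \<open>x^i \<otimes> v\<close> is nonzero for \<open>v \<noteq> 0\<close>. Additive maps into
  \<open>V\<close> that respect the relators settle this. They have to be twisted: coefficients of
  Laurent polynomials stand on the left, whereas the tensor product absorbs scalars on the right of
  \<open>x^i\<close>, and \<open>a x^i = x^i \<sigma>^-i(a)\<close>. With the coordinates at hand,
  later arguments are identities in \<open>V\<close>, degree by degree. Division cancels only the
  top degree. As \<open>x\<close> is invertible, \<open>v\<close> can be shifted until its top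
  degree meets that of \<open>u\<close>, and the comparison of lengths then keeps the shifted
  \<open>v\<close> from reaching below the lowest degree of \<open>u\<close>. The twist is also why
  the uni-annihilator property is not evident: one element of \<open>D\<close> acts on different
  components through different powers of \<open>\<sigma>\<close>, so their annihilators have no
  reason to agree in general.\<close>

lemma finsum_hom:
  assumes "abelian_monoid G" "abelian_monoid H"
    and closed: "h \<in> carrier G \<rightarrow> carrier H"
    and add: "\<And>x y. \<lbrakk>x \<in> carrier G; y \<in> carrier G\<rbrakk> \<Longrightarrow> h (x \<oplus>\<^bsub>G\<^esub> y) = h x \<oplus>\<^bsub>H\<^esub> h y"
    and zero: "h \<zero>\<^bsub>G\<^esub> = \<zero>\<^bsub>H\<^esub>"
    and f: "f \<in> A \<rightarrow> carrier G"
  shows "h (finsum G f A) = finsum H (\<lambda>i. h (f i)) A"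
proof -
  interpret G: abelian_monoid G by fact
  interpret H: abelian_monoid H by fact
  show ?thesis using f
  proof (induction A rule: infinite_finite_induct)
    case (insert a A)
    then have "f \<in> A \<rightarrow> carrier G" "f a \<in> carrier G" by auto
    moreover from this closed have "(\<lambda>i. h (f i)) \<in> A \<rightarrow> carrier H" "h (f a) \<in> carrier H" by auto
    ultimately show ?case using insert by (simp add: add G.finsum_insert H.finsum_insert G.finsum_closed)
  \<comment> \<open>An infinite index set ends here too: both sums are then zero by
    convention.\<close>
  qed (auto simp: zero)
qed

lemma (in abelian_monoid) finsum_swap:
  assumes "\<And>i j. \<lbrakk>i \<in> A; j \<in> B\<rbrakk> \<Longrightarrow> f i j \<in> carrier G"
  shows "(\<Oplus>i\<in>A. \<Oplus>j\<in>B. f i j) = (\<Oplus>j\<in>B. \<Oplus>i\<in>A. f i j)"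
  using assms
proof (induction A rule: infinite_finite_induct)
  case (insert a A)
  have "(\<Oplus>j\<in>B. \<Oplus>i\<in>insert a A. f i j) = (\<Oplus>j\<in>B. f a j \<oplus> (\<Oplus>i\<in>A. f i j))"
    using insert by (intro finsum_cong') (auto intro!: finsum_insert finsum_closed)
  also have "\<dots> = (\<Oplus>j\<in>B. f a j) \<oplus> (\<Oplus>j\<in>B. \<Oplus>i\<in>A. f i j)"
    using insert.prems by (intro finsum_addf) (auto intro!: finsum_closed)
  also have "\<dots> = (\<Oplus>i\<in>insert a A. \<Oplus>j\<in>B. f i j)"
    using insert by (subst finsum_insert) (auto intro!: finsum_closed)
  finally show ?case by simp
qed simp_all

lemma (in abelian_monoid) finsum_single:
  assumes "finite A" "k \<in> A" "f k \<in> carrier G" "\<And>i. \<lbrakk>i \<in> A; i \<noteq> k\<rbrakk> \<Longrightarrow> f i = \<zero>"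
  shows "finsum G f A = f k"
proof -
  have "finsum G f A = finsum G f {k}"
  proof (rule add.finprod_mono_neutral_cong_right)
    show "f \<in> A \<rightarrow> carrier G" using assms by (metis Pi_I zero_closed)
  qed (use assms in auto)
  then show ?thesis using assms by (simp add: finsum_insert)
qed

text \<open>Cancellation in \<open>h 0 + h 0 = h 0\<close>. The map is a bare function because this
  is applied to scalar multiplication in either argument, to coordinates and to
  \<open>x^i \<otimes> v\<close> as a function of \<open>v\<close>.\<close>

lemma additive_zero:
  assumes "abelian_group G" "abelian_group H"
    and closed: "\<And>x. x \<in> carrier G \<Longrightarrow> h x \<in> carrier H"
    and add: "\<And>x y. \<lbrakk>x \<in> carrier G; y \<in> carrier G\<rbrakk> \<Longrightarrow> h (x \<oplus>\<^bsub>G\<^esub> y) = h x \<oplus>\<^bsub>H\<^esub> h y"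
  shows "h \<zero>\<^bsub>G\<^esub> = \<zero>\<^bsub>H\<^esub>"
proof -
  interpret G: abelian_group G by fact
  interpret H: abelian_group H by fact
  show ?thesis using add[of "\<zero>\<^bsub>G\<^esub>" "\<zero>\<^bsub>G\<^esub>"] closed[of "\<zero>\<^bsub>G\<^esub>"] by (simp add: H.add.l_cancel_one)
qed

lemma additive_diff:
  assumes "abelian_group G" "abelian_group H"
    and closed: "\<And>x. x \<in> carrier G \<Longrightarrow> h x \<in> carrier H"
    and add: "\<And>x y. \<lbrakk>x \<in> carrier G; y \<in> carrier G\<rbrakk> \<Longrightarrow> h (x \<oplus>\<^bsub>G\<^esub> y) = h x \<oplus>\<^bsub>H\<^esub> h y"
    and xy: "x \<in> carrier G" "y \<in> carrier G"
  shows "h (x \<ominus>\<^bsub>G\<^esub> y) = h x \<ominus>\<^bsub>H\<^esub> h y"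
proof -
  interpret G: abelian_group G by fact
  interpret H: abelian_group H by fact
  have "h (x \<ominus>\<^bsub>G\<^esub> y) \<oplus>\<^bsub>H\<^esub> h y = h (x \<ominus>\<^bsub>G\<^esub> y \<oplus>\<^bsub>G\<^esub> y)" using xy by (simp add: add)
  also have "x \<ominus>\<^bsub>G\<^esub> y \<oplus>\<^bsub>G\<^esub> y = x" using xy by (simp add: G.minus_eq G.a_assoc G.l_neg)
  finally show ?thesis using xy closed
    by (metis G.minus_closed H.add.inv_solve_right H.minus_eq)
qed

context left_module
begin

lemma smult_r_null: "a \<in> carrier R \<Longrightarrow> a \<odot>\<^bsub>M\<^esub> \<zero>\<^bsub>M\<^esub> = \<zero>\<^bsub>M\<^esub>"
  by (rule additive_zero[OF M.abelian_group_axioms M.abelian_group_axioms]) (auto simp: smult_closed smult_r_distr)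

lemma smult_l_null: "u \<in> carrier M \<Longrightarrow> \<zero>\<^bsub>R\<^esub> \<odot>\<^bsub>M\<^esub> u = \<zero>\<^bsub>M\<^esub>"
  by (rule additive_zero[OF R.abelian_group_axioms M.abelian_group_axioms, of "\<lambda>a. a \<odot>\<^bsub>M\<^esub> u"])
     (auto simp: smult_closed smult_l_distr)

lemma smult_r_diff:
  "\<lbrakk>a \<in> carrier R; u \<in> carrier M; v \<in> carrier M\<rbrakk> \<Longrightarrow>
    a \<odot>\<^bsub>M\<^esub> (u \<ominus>\<^bsub>M\<^esub> v) = a \<odot>\<^bsub>M\<^esub> u \<ominus>\<^bsub>M\<^esub> a \<odot>\<^bsub>M\<^esub> v"
  by (rule additive_diff[OF M.abelian_group_axioms M.abelian_group_axioms]) (auto simp: smult_closed smult_r_distr)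

lemma smult_l_diff:
  "\<lbrakk>a \<in> carrier R; b \<in> carrier R; u \<in> carrier M\<rbrakk> \<Longrightarrow>
    (a \<ominus>\<^bsub>R\<^esub> b) \<odot>\<^bsub>M\<^esub> u = a \<odot>\<^bsub>M\<^esub> u \<ominus>\<^bsub>M\<^esub> b \<odot>\<^bsub>M\<^esub> u"
  by (rule additive_diff[OF R.abelian_group_axioms M.abelian_group_axioms, of "\<lambda>a. a \<odot>\<^bsub>M\<^esub> u"])
     (auto simp: smult_closed smult_l_distr)

lemma diff_eq_iff:
  assumes "u \<in> carrier M" "v \<in> carrier M" "w \<in> carrier M"
  shows "u \<ominus>\<^bsub>M\<^esub> v = w \<longleftrightarrow> u = v \<oplus>\<^bsub>M\<^esub> w"
  using assms by (metis M.add.inv_solve_right M.a_comm M.minus_eq)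

lemma cyclic_submodule:
  assumes u: "u \<in> carrier M"
  shows "submodule {a \<odot>\<^bsub>M\<^esub> u | a. a \<in> carrier R} R M"
proof (intro submodule.intro subgroup.intro submodule_axioms.intro)
  let ?N = "{a \<odot>\<^bsub>M\<^esub> u | a. a \<in> carrier R}"
  show "?N \<subseteq> carrier (add_monoid M)" using u by (auto simp: smult_closed)
  show "x \<otimes>\<^bsub>add_monoid M\<^esub> y \<in> ?N" if "x \<in> ?N" "y \<in> ?N" for x y
    using that u by (force simp: smult_l_distr[symmetric])
  show "\<one>\<^bsub>add_monoid M\<^esub> \<in> ?N" using smult_l_null[OF u] by (auto intro!: exI[of _ "\<zero>\<^bsub>R\<^esub>"])
  show "inv\<^bsub>add_monoid M\<^esub> x \<in> ?N" if "x \<in> ?N" for x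
  proof -
    from that obtain a where a: "a \<in> carrier R" "x = a \<odot>\<^bsub>M\<^esub> u" by blast
    \<comment> \<open>Writing the negative as \<open>0 - a\<close> brings it under additivity in the
      scalar.\<close>
    then have "\<ominus>\<^bsub>M\<^esub> x = (\<zero>\<^bsub>R\<^esub> \<ominus>\<^bsub>R\<^esub> a) \<odot>\<^bsub>M\<^esub> u"
      using u by (simp add: smult_l_diff smult_l_null smult_closed M.minus_eq)
    then show ?thesis using a by (auto simp: a_inv_def)
  qed
  show "a \<odot>\<^bsub>M\<^esub> x \<in> ?N" if "a \<in> carrier R" "x \<in> ?N" for a x
    using that u by (force simp: smult_assoc[symmetric])
qed

lemma submodule_carrier: "submodule N R M \<Longrightarrow> u \<in> N \<Longrightarrow> u \<in> carrier M"
  using subgroup.subset[of N "add_monoid M"] by (auto simp: submodule_def)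

lemma submodule_zero: "submodule N R M \<Longrightarrow> \<zero>\<^bsub>M\<^esub> \<in> N"
  using subgroup.one_closed[of N "add_monoid M"] by (simp add: submodule_def)

lemma submodule_add: "\<lbrakk>submodule N R M; u \<in> N; v \<in> N\<rbrakk> \<Longrightarrow> u \<oplus>\<^bsub>M\<^esub> v \<in> N"
  using subgroup.m_closed[of N "add_monoid M"] by (simp add: submodule_def)

lemma submodule_diff: "\<lbrakk>submodule N R M; u \<in> N; v \<in> N\<rbrakk> \<Longrightarrow> u \<ominus>\<^bsub>M\<^esub> v \<in> N"
  using subgroup.m_inv_closed[of N "add_monoid M" v] submodule_add[of N u "\<ominus>\<^bsub>M\<^esub> v"]
  by (simp add: submodule_def a_minus_def a_inv_def)

text \<open>\<open>N\<close> is itself a member of the intersected family, which gives one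
  inclusion; every other member contains all multiples of \<open>u\<close>, which gives the
  other.\<close>

lemma generates_submoduleI:
  assumes N: "submodule N R M" and u: "u \<in> N"
    and gen: "\<And>v. v \<in> N \<Longrightarrow> \<exists>a\<in>carrier R. v = a \<odot>\<^bsub>M\<^esub> u"
  shows "generates_submodule R M u N"
  unfolding generates_submodule_def
proof
  show "u \<in> carrier M" using submodule_carrier[OF N u] .
  have "v \<in> H" if "v \<in> N" "submodule H R M" "u \<in> H" for v H
    using gen[OF that(1)] submodule.smult_closed[OF that(2) _ that(3)] by auto
  then show "\<Inter>{H. submodule H R M \<and> u \<in> H} = N" using N u by blast
qed

end

text \<open>The cyclic submodule of \<open>v\<close> contains \<open>1 v = v\<close>, so it is
  nonzero and simplicity makes it all of the module. Cancelling a component in a given degree rests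
  on this.\<close>

lemma (in simple_module) smult_transitive:
  assumes v: "v \<in> carrier M" "v \<noteq> \<zero>\<^bsub>M\<^esub>" and w: "w \<in> carrier M"
  obtains a where "a \<in> carrier R" "a \<odot>\<^bsub>M\<^esub> v = w"
proof -
  let ?N = "{a \<odot>\<^bsub>M\<^esub> v | a. a \<in> carrier R}"
  have "v \<in> ?N" using smult_one[OF v(1)] by (metis (mono_tags, lifting) R.one_closed mem_Collect_eq)
  then have "?N \<noteq> {\<zero>\<^bsub>M\<^esub>}" using v(2) by blast
  then have "?N = carrier M" using submodule_trivial[OF cyclic_submodule[OF v(1)]] by blast
  then have "w \<in> ?N" using w by simp
  then show thesis using that by blast
qed

section \<open>The skew Laurent polynomial ring\<close>

locale skew_laurent_ring = D?: ring D
  for D :: "('a, 'm) ring_scheme" (structure) +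
  fixes \<sigma> :: "'a \<Rightarrow> 'a"
  assumes automorphism: "\<sigma> \<in> ring_iso D D"
begin

abbreviation L where "L \<equiv> skew_laurent D \<sigma>"
abbreviation P where "P \<equiv> automorphism_power D \<sigma>"
abbreviation mon where "mon \<equiv> laurent_monom D"

section \<open>Integer powers of the automorphism\<close>

lemma bij_automorphism: "bij_betw \<sigma> (carrier D) (carrier D)"
  using automorphism by (simp add: ring_iso_def)

lemma inverse_automorphism: "inv_into (carrier D) \<sigma> \<in> ring_iso D D"
  using ring_iso_set_sym[OF ring_axioms automorphism] .

lemma funpow_ring_hom: "h \<in> ring_hom D D \<Longrightarrow> h ^^ n \<in> ring_hom D D"
  by (induction n) (auto simp: ring_hom_def Pi_iff)

lemma P_hom: "P i \<in> ring_hom D D"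
  using automorphism inverse_automorphism
  by (auto simp: automorphism_power_def ring_iso_def intro: funpow_ring_hom)

lemma P_closed [simp, intro]: "a \<in> carrier D \<Longrightarrow> P i a \<in> carrier D"
  using ring_hom_closed[OF P_hom] .

lemma P_add: "\<lbrakk>a \<in> carrier D; b \<in> carrier D\<rbrakk> \<Longrightarrow> P i (a \<oplus> b) = P i a \<oplus> P i b"
  using ring_hom_add[OF P_hom] .

lemma P_mult: "\<lbrakk>a \<in> carrier D; b \<in> carrier D\<rbrakk> \<Longrightarrow> P i (a \<otimes> b) = P i a \<otimes> P i b"
  using ring_hom_mult[OF P_hom] .

lemma P_one [simp]: "P i \<one> = \<one>"
  using ring_hom_one[OF P_hom] .

lemma P_zero [simp]: "P i \<zero> = \<zero>"
  using ring_hom_zero[OF P_hom] ring_axioms by blast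

lemma P_0 [simp]: "P 0 a = a"
  by (simp add: automorphism_power_def)

lemma P_Suc:
  assumes a: "a \<in> carrier D"
  shows "P (i + 1) a = \<sigma> (P i a)"
proof (cases "0 \<le> i")
  case True
  then show ?thesis by (simp add: automorphism_power_def nat_add_distrib)
next
  case False
  then obtain n where n: "nat (- i) = Suc n" by (cases "nat (- i)") auto
  then have n': "nat (- (i + 1)) = n" by simp
  let ?\<tau> = "inv_into (carrier D) \<sigma>"
  have *: "(?\<tau> ^^ n) a \<in> carrier D"
    using ring_hom_closed[OF funpow_ring_hom] inverse_automorphism a by (auto simp: ring_iso_def)
  \<comment> \<open>At \<open>i = -1\<close> the definition switches to its nonnegative branch;
    there \<open>n = 0\<close>, and both branches are the empty iterate.\<close>
  have "P (i + 1) a = (?\<tau> ^^ n) a"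
    using False n n' by (cases "i = -1") (auto simp: automorphism_power_def)
  also have "\<dots> = \<sigma> (?\<tau> ((?\<tau> ^^ n) a))"
    using f_inv_into_f[of "(?\<tau> ^^ n) a" \<sigma> "carrier D"] bij_automorphism *
    by (simp add: bij_betw_def)
  also have "\<dots> = \<sigma> (P i a)"
    using False n by (simp add: automorphism_power_def)
  finally show ?thesis .
qed

text \<open>Induction on \<open>i\<close> upwards and downwards from 0. The downward step proves the
  equation after applying \<open>\<sigma>\<close> and then uses injectivity on the carrier.\<close>

lemma P_P:
  assumes a: "a \<in> carrier D"
  shows "P i (P j a) = P (i + j) a"
proof (induction i rule: int_induct[where k = 0])
  case (step1 i)
  then show ?case using P_Suc[of a "i + j"] P_Suc[of "P j a" i] a by (simp add: algebra_simps)
next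
  case (step2 i)
  have "\<sigma> (P (i - 1) (P j a)) = \<sigma> (P (i - 1 + j) a)"
    using step2 P_Suc[of a "i - 1 + j"] P_Suc[of "P j a" "i - 1"] a by (simp add: algebra_simps)
  then show ?case
    using bij_automorphism a by (auto simp: bij_betw_def inj_on_def)
qed simp

lemma P_cancel [simp]:
  "a \<in> carrier D \<Longrightarrow> P i (P (- i) a) = a"
  "a \<in> carrier D \<Longrightarrow> P (- i) (P i a) = a"
  by (simp_all add: P_P)

lemma P_finsum: "f \<in> A \<rightarrow> carrier D \<Longrightarrow> P i (finsum D f A) = (\<Oplus>j\<in>A. P i (f j))"
  by (rule finsum_hom) (auto simp: P_add intro: abelian_monoid_axioms)

section \<open>Coefficients and products of skew Laurent polynomials\<close>

lemma laurent_carrier: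
  "f \<in> carrier L \<longleftrightarrow> (\<forall>i. f i \<in> carrier D) \<and> finite {i. f i \<noteq> \<zero>}"
  by (simp add: skew_laurent_def)

lemma laurent_closed [intro]: "f \<in> carrier L \<Longrightarrow> f i \<in> carrier D"
  by (simp add: laurent_carrier)

lemma laurent_carrierI:
  assumes "\<And>i. f i \<in> carrier D" "finite A" "\<And>i. i \<notin> A \<Longrightarrow> f i = \<zero>"
  shows "f \<in> carrier L"
  using assms finite_subset[of "{i. f i \<noteq> \<zero>}" A] by (auto simp: laurent_carrier)

lemma laurent_support:
  assumes "f \<in> carrier L"
  obtains A where "finite A" "\<forall>i. i \<notin> A \<longrightarrow> f i = \<zero>"
  using assms by (auto simp: laurent_carrier)

lemma laurent_add: "(f \<oplus>\<^bsub>L\<^esub> g) i = f i \<oplus> g i"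
  by (simp add: skew_laurent_def)

lemma laurent_zero: "\<zero>\<^bsub>L\<^esub> i = \<zero>"
  by (simp add: skew_laurent_def)

lemma laurent_one: "\<one>\<^bsub>L\<^esub> = mon \<one> 0"
  by (simp add: skew_laurent_def laurent_monom_def)

text \<open>The defining sum ranges over the exact support of \<open>f\<close>. Allowing any finite
  set that contains the support lets sums for different factors share one index set.\<close>

lemma laurent_mult:
  assumes f: "f \<in> carrier L" and g: "g \<in> carrier L"
    and A: "finite A" "\<forall>i. i \<notin> A \<longrightarrow> f i = \<zero>"
  shows "(f \<otimes>\<^bsub>L\<^esub> g) n = (\<Oplus>i\<in>A. f i \<otimes> P i (g (n - i)))"
proof -
  have "(\<Oplus>i\<in>{i. f i \<noteq> \<zero>}. f i \<otimes> P i (g (n - i))) = (\<Oplus>i\<in>A. f i \<otimes> P i (g (n - i)))"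
    by (rule add.finprod_mono_neutral_cong_left)
       (use A laurent_closed[OF f] laurent_closed[OF g] in \<open>auto\<close>)
  then show ?thesis by (simp add: skew_laurent_def)
qed

lemma laurent_add_closed:
  assumes f: "f \<in> carrier L" and g: "g \<in> carrier L"
  shows "f \<oplus>\<^bsub>L\<^esub> g \<in> carrier L"
proof -
  obtain A B where "finite A" "\<forall>i. i \<notin> A \<longrightarrow> f i = \<zero>" "finite B" "\<forall>i. i \<notin> B \<longrightarrow> g i = \<zero>"
    using laurent_support[OF f] laurent_support[OF g] by metis
  then show ?thesis
    using f g by (intro laurent_carrierI[of _ "A \<union> B"]) (auto simp: laurent_add)
qed

lemma laurent_mult_support:
  assumes f: "f \<in> carrier L" and g: "g \<in> carrier L"
    and A: "finite A" "\<forall>i. i \<notin> A \<longrightarrow> f i = \<zero>"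
    and B: "\<forall>i. i \<notin> B \<longrightarrow> g i = \<zero>"
    and n: "n \<notin> (\<lambda>(i, j). i + j) ` (A \<times> B)"
  shows "(f \<otimes>\<^bsub>L\<^esub> g) n = \<zero>"
  unfolding laurent_mult[OF f g A]
proof (rule add.finprod_one_eqI)
  fix i assume "i \<in> A"
  with n have "n - i \<notin> B" by (force simp: image_iff)
  with laurent_closed[OF f] B show "f i \<otimes> P i (g (n - i)) = \<zero>" by simp
qed

lemma laurent_mult_closed:
  assumes f: "f \<in> carrier L" and g: "g \<in> carrier L"
  shows "f \<otimes>\<^bsub>L\<^esub> g \<in> carrier L"
proof -
  obtain A B where A: "finite A" "\<forall>i. i \<notin> A \<longrightarrow> f i = \<zero>"
    and B: "finite B" "\<forall>i. i \<notin> B \<longrightarrow> g i = \<zero>"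
    using laurent_support[OF f] laurent_support[OF g] by metis
  show ?thesis
  proof (rule laurent_carrierI)
    show "(f \<otimes>\<^bsub>L\<^esub> g) n \<in> carrier D" for n
      unfolding laurent_mult[OF f g A] using f g by (auto intro!: finsum_closed)
    show "finite ((\<lambda>(i, j). i + j) ` (A \<times> B))" using A B by simp
    show "(f \<otimes>\<^bsub>L\<^esub> g) n = \<zero>" if "n \<notin> (\<lambda>(i, j). i + j) ` (A \<times> B)" for n
      by (rule laurent_mult_support[OF f g A B(2) that])
  qed
qed

text \<open>Both sides are double sums. After exchanging the sums, the substitution
  \<open>i = j + k\<close> matches them, since \<open>\<sigma>^j \<sigma>^k = \<sigma>^(j+k)\<close>
  turns the twist by the degree of the product \<open>f g\<close> into the two successive twists on
  the right.\<close>

lemma laurent_mult_assoc: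
  assumes f: "f \<in> carrier L" and g: "g \<in> carrier L" and h: "h \<in> carrier L"
  shows "(f \<otimes>\<^bsub>L\<^esub> g) \<otimes>\<^bsub>L\<^esub> h = f \<otimes>\<^bsub>L\<^esub> (g \<otimes>\<^bsub>L\<^esub> h)"
proof
  fix n
  obtain A B where A: "finite A" "\<forall>i. i \<notin> A \<longrightarrow> f i = \<zero>"
    and B: "finite B" "\<forall>i. i \<notin> B \<longrightarrow> g i = \<zero>"
    using laurent_support[OF f] laurent_support[OF g] by metis
  define C where "C = (\<lambda>(i, j). i + j) ` (A \<times> B)"
  have C: "finite C" using A B by (simp add: C_def)
  note closed = laurent_closed[OF f] laurent_closed[OF g] laurent_closed[OF h]
  have "((f \<otimes>\<^bsub>L\<^esub> g) \<otimes>\<^bsub>L\<^esub> h) n = (\<Oplus>i\<in>C. (f \<otimes>\<^bsub>L\<^esub> g) i \<otimes> P i (h (n - i)))"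
    by (rule laurent_mult[OF laurent_mult_closed[OF f g] h C])
       (use laurent_mult_support[OF f g A B(2)] in \<open>simp add: C_def\<close>)
  also have "\<dots> = (\<Oplus>i\<in>C. \<Oplus>j\<in>A. f j \<otimes> P j (g (i - j)) \<otimes> P i (h (n - i)))"
    using closed A(1)
    by (intro finsum_cong') (auto simp: laurent_mult[OF f g A] intro!: finsum_ldistr finsum_closed)
  also have "\<dots> = (\<Oplus>j\<in>A. \<Oplus>i\<in>C. f j \<otimes> P j (g (i - j)) \<otimes> P i (h (n - i)))"
    using closed by (intro finsum_swap) auto
  also have "\<dots> = (\<Oplus>j\<in>A. f j \<otimes> P j ((g \<otimes>\<^bsub>L\<^esub> h) (n - j)))"
  proof (rule finsum_cong')
    fix j assume j: "j \<in> A"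
    \<comment> \<open>For fixed \<open>j\<close> only the degrees \<open>i\<close> in the translate
      \<open>j + B\<close> contribute, because \<open>B\<close> covers the support of
      \<open>g\<close>; \<open>C\<close> contains all these translates.\<close>
    have "(\<Oplus>i\<in>C. f j \<otimes> P j (g (i - j)) \<otimes> P i (h (n - i))) =
          (\<Oplus>i\<in>(\<lambda>k. j + k) ` B. f j \<otimes> P j (g (i - j)) \<otimes> P i (h (n - i)))"
    proof (rule add.finprod_mono_neutral_cong_right)
      show "(\<lambda>k. j + k) ` B \<subseteq> C" using j by (auto simp: C_def)
      show "f j \<otimes> P j (g (i - j)) \<otimes> P i (h (n - i)) = \<zero>" if "i \<in> C - (\<lambda>k. j + k) ` B" for i
      proof -
        have "i - j \<notin> B" using that by (force simp: image_iff)
        then show ?thesis using B closed by simp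
      qed
    qed (use C closed in auto)
    also have "\<dots> = (\<Oplus>k\<in>B. f j \<otimes> P j (g k) \<otimes> P (j + k) (h (n - (j + k))))"
      using closed by (subst finsum_reindex) auto
    also have "\<dots> = (\<Oplus>k\<in>B. f j \<otimes> P j (g k \<otimes> P k (h (n - j - k))))"
      using closed by (intro finsum_cong') (auto simp: P_mult P_P m_assoc diff_diff_eq)
    also have "\<dots> = f j \<otimes> (\<Oplus>k\<in>B. P j (g k \<otimes> P k (h (n - j - k))))"
      using closed B(1) by (intro finsum_rdistr[symmetric]) auto
    also have "\<dots> = f j \<otimes> P j ((g \<otimes>\<^bsub>L\<^esub> h) (n - j))"
      unfolding laurent_mult[OF g h B] using closed by (subst P_finsum) auto
    finally show "(\<Oplus>i\<in>C. f j \<otimes> P j (g (i - j)) \<otimes> P i (h (n - i))) =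
        f j \<otimes> P j ((g \<otimes>\<^bsub>L\<^esub> h) (n - j))" .
  qed (use closed laurent_closed[OF laurent_mult_closed[OF g h]] in auto)
  also have "\<dots> = (f \<otimes>\<^bsub>L\<^esub> (g \<otimes>\<^bsub>L\<^esub> h)) n"
    by (rule laurent_mult[OF f laurent_mult_closed[OF g h] A, symmetric])
  finally show "((f \<otimes>\<^bsub>L\<^esub> g) \<otimes>\<^bsub>L\<^esub> h) n = (f \<otimes>\<^bsub>L\<^esub> (g \<otimes>\<^bsub>L\<^esub> h)) n" .
qed

lemma mon_closed [simp, intro]: "a \<in> carrier D \<Longrightarrow> mon a i \<in> carrier L"
  by (rule laurent_carrierI[of _ "{i}"]) (auto simp: laurent_monom_def)

lemma mon_mult:
  assumes a: "a \<in> carrier D" and g: "g \<in> carrier L"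
  shows "(mon a k \<otimes>\<^bsub>L\<^esub> g) n = a \<otimes> P k (g (n - k))"
  using a laurent_closed[OF g]
  by (subst laurent_mult[OF mon_closed[OF a] g, of "{k}"]) (auto simp: laurent_monom_def finsum_insert)

lemma mon_mult_mon:
  assumes a: "a \<in> carrier D" and b: "b \<in> carrier D"
  shows "mon a i \<otimes>\<^bsub>L\<^esub> mon b j = mon (a \<otimes> P i b) (i + j)"
proof
  fix n show "(mon a i \<otimes>\<^bsub>L\<^esub> mon b j) n = mon (a \<otimes> P i b) (i + j) n"
    using a b by (subst mon_mult[OF a mon_closed[OF b]]) (auto simp: laurent_monom_def)
qed

text \<open>This is the right action of \<open>D\<close> on Laurent polynomials, the one used by the
  tensor product: a scalar that moves past \<open>x^n\<close> is twisted by
  \<open>\<sigma>^n\<close>. The balancing condition for the coordinates comes from it.\<close>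

lemma mult_mon_0:
  assumes f: "f \<in> carrier L" and a: "a \<in> carrier D"
  shows "(f \<otimes>\<^bsub>L\<^esub> mon a 0) n = f n \<otimes> P n a"
proof -
  obtain A where A: "finite A" "\<forall>i. i \<notin> A \<longrightarrow> f i = \<zero>" using laurent_support[OF f] by metis
  \<comment> \<open>Only \<open>i = n\<close> contributes, so \<open>n\<close> is added to the index
    set in case \<open>f n\<close> vanishes.\<close>
  have "(f \<otimes>\<^bsub>L\<^esub> mon a 0) n = (\<Oplus>i\<in>insert n A. f i \<otimes> P i (mon a 0 (n - i)))"
    by (rule laurent_mult[OF f mon_closed[OF a]]) (use A in auto)
  also have "\<dots> = f n \<otimes> P n (mon a 0 (n - n))"
    using laurent_closed[OF f] a A by (intro finsum_single) (auto simp: laurent_monom_def)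
  finally show ?thesis by (simp add: laurent_monom_def)
qed

lemma ring_laurent: "ring L"
proof (rule ringI)
  show "abelian_group L"
  proof (rule abelian_groupI)
    fix f assume f: "f \<in> carrier L"
    then obtain A where A: "finite A" "\<forall>i. i \<notin> A \<longrightarrow> f i = \<zero>" by (rule laurent_support)
    show "\<exists>g\<in>carrier L. g \<oplus>\<^bsub>L\<^esub> f = \<zero>\<^bsub>L\<^esub>"
    proof
      show "(\<lambda>i. \<ominus> f i) \<in> carrier L"
        using laurent_closed[OF f] A by (intro laurent_carrierI[of _ A]) auto
      show "(\<lambda>i. \<ominus> f i) \<oplus>\<^bsub>L\<^esub> f = \<zero>\<^bsub>L\<^esub>"
        using laurent_closed[OF f] by (auto simp: laurent_add laurent_zero fun_eq_iff l_neg)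
    qed
  qed (auto simp: laurent_add_closed laurent_add laurent_zero fun_eq_iff laurent_closed a_ac
      intro: laurent_carrierI[of _ "{}"])
  show "monoid L"
  proof (rule monoidI)
    fix f assume f: "f \<in> carrier L"
    show "\<one>\<^bsub>L\<^esub> \<otimes>\<^bsub>L\<^esub> f = f"
      using f by (auto simp: laurent_one mon_mult laurent_closed)
    show "f \<otimes>\<^bsub>L\<^esub> \<one>\<^bsub>L\<^esub> = f"
      using f by (auto simp: laurent_one mult_mon_0 laurent_closed)
  qed (auto simp: laurent_one laurent_mult_closed laurent_mult_assoc)
next
  fix f g h assume f: "f \<in> carrier L" and g: "g \<in> carrier L" and h: "h \<in> carrier L"
  obtain A B C where A: "finite A" "\<forall>i. i \<notin> A \<longrightarrow> f i = \<zero>"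
    and B: "finite B" "\<forall>i. i \<notin> B \<longrightarrow> g i = \<zero>" and C: "finite C" "\<forall>i. i \<notin> C \<longrightarrow> h i = \<zero>"
    using laurent_support[OF f] laurent_support[OF g] laurent_support[OF h] by metis
  note closed = laurent_closed[OF f] laurent_closed[OF g] laurent_closed[OF h]
  show "(f \<oplus>\<^bsub>L\<^esub> g) \<otimes>\<^bsub>L\<^esub> h = f \<otimes>\<^bsub>L\<^esub> h \<oplus>\<^bsub>L\<^esub> g \<otimes>\<^bsub>L\<^esub> h"
  proof
    fix n
    let ?E = "A \<union> B"
    have "((f \<oplus>\<^bsub>L\<^esub> g) \<otimes>\<^bsub>L\<^esub> h) n = (\<Oplus>i\<in>?E. (f \<oplus>\<^bsub>L\<^esub> g) i \<otimes> P i (h (n - i)))"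
      using f g h A B by (intro laurent_mult) (auto simp: laurent_add laurent_add_closed)
    also have "\<dots> = (\<Oplus>i\<in>?E. f i \<otimes> P i (h (n - i)) \<oplus> g i \<otimes> P i (h (n - i)))"
      using closed by (intro finsum_cong') (auto simp: laurent_add l_distr)
    also have "\<dots> = (\<Oplus>i\<in>?E. f i \<otimes> P i (h (n - i))) \<oplus> (\<Oplus>i\<in>?E. g i \<otimes> P i (h (n - i)))"
      using closed by (intro finsum_addf) auto
    also have "\<dots> = (f \<otimes>\<^bsub>L\<^esub> h \<oplus>\<^bsub>L\<^esub> g \<otimes>\<^bsub>L\<^esub> h) n"
      using A B by (simp add: laurent_add laurent_mult[OF f h, of ?E] laurent_mult[OF g h, of ?E])
    finally show "((f \<oplus>\<^bsub>L\<^esub> g) \<otimes>\<^bsub>L\<^esub> h) n = (f \<otimes>\<^bsub>L\<^esub> h \<oplus>\<^bsub>L\<^esub> g \<otimes>\<^bsub>L\<^esub> h) n" .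
  qed
  show "h \<otimes>\<^bsub>L\<^esub> (f \<oplus>\<^bsub>L\<^esub> g) = h \<otimes>\<^bsub>L\<^esub> f \<oplus>\<^bsub>L\<^esub> h \<otimes>\<^bsub>L\<^esub> g"
  proof
    fix n
    have "(h \<otimes>\<^bsub>L\<^esub> (f \<oplus>\<^bsub>L\<^esub> g)) n = (\<Oplus>i\<in>C. h i \<otimes> P i (f (n - i)) \<oplus> h i \<otimes> P i (g (n - i)))"
      unfolding laurent_mult[OF h laurent_add_closed[OF f g] C]
      using closed by (intro finsum_cong') (auto simp: laurent_add r_distr P_add)
    also have "\<dots> = (\<Oplus>i\<in>C. h i \<otimes> P i (f (n - i))) \<oplus> (\<Oplus>i\<in>C. h i \<otimes> P i (g (n - i)))"
      using closed by (intro finsum_addf) auto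
    also have "\<dots> = (h \<otimes>\<^bsub>L\<^esub> f \<oplus>\<^bsub>L\<^esub> h \<otimes>\<^bsub>L\<^esub> g) n"
      by (simp add: laurent_add laurent_mult[OF h f C] laurent_mult[OF h g C])
    finally show "(h \<otimes>\<^bsub>L\<^esub> (f \<oplus>\<^bsub>L\<^esub> g)) n = (h \<otimes>\<^bsub>L\<^esub> f \<oplus>\<^bsub>L\<^esub> h \<otimes>\<^bsub>L\<^esub> g) n" .
  qed
qed

sublocale L: ring L
  by (rule ring_laurent)

lemma mon_hom: "(\<lambda>a. mon a 0) \<in> ring_hom D L"
  by (rule ring_hom_memI) (auto simp: mon_mult_mon laurent_one, auto simp: fun_eq_iff laurent_add laurent_monom_def)

text \<open>Checked coefficient by coefficient: evaluation at a degree is additive and passes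
  through the sum. It reduces statements about \<open>s \<otimes> v\<close> to monomials
  \<open>s\<close>.\<close>

lemma laurent_eq_finsum:
  assumes f: "f \<in> carrier L" and A: "finite A" "\<forall>i. i \<notin> A \<longrightarrow> f i = \<zero>"
  shows "f = (\<Oplus>\<^bsub>L\<^esub>i\<in>A. mon (f i) i)"
proof
  fix j
  have "(\<Oplus>\<^bsub>L\<^esub>i\<in>A. mon (f i) i) j = (\<Oplus>i\<in>A. mon (f i) i j)"
    by (rule finsum_hom[of L D "\<lambda>g. g j"])
       (use f in \<open>auto simp: laurent_add laurent_zero intro: L.abelian_monoid_axioms abelian_monoid_axioms\<close>)
  also have "\<dots> = f j"
  proof (cases "j \<in> A")
    case True
    then have "(\<Oplus>i\<in>A. mon (f i) i j) = mon (f j) j j"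
      using f A by (intro finsum_single) (auto simp: laurent_monom_def)
    then show ?thesis by (simp add: laurent_monom_def)
  next
    case False
    then have "(\<Oplus>i\<in>A. mon (f i) i j) = \<zero>"
      by (intro add.finprod_one_eqI) (auto simp: laurent_monom_def)
    with False A show ?thesis by simp
  qed
  finally show "f j = (\<Oplus>\<^bsub>L\<^esub>i\<in>A. mon (f i) i) j" by simp
qed

end


section \<open>Extension of scalars\<close>

text \<open>The tensor construction is carried out along an arbitrary ring homomorphism; Laurent
  polynomials enter only once the universal property is available.\<close>

locale scalar_extension = V: left_module R V + S: ring S
  for R :: "('a, 'm) ring_scheme" and S :: "('s, 'k) ring_scheme" and \<phi> :: "'a \<Rightarrow> 's"
    and V :: "('a, 'b, 'n) module_scheme" +
  assumes hom: "\<phi> \<in> ring_hom R S"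
begin

abbreviation F where "F \<equiv> free_Abelian_group (carrier S \<times> carrier V)"
abbreviation K where "K \<equiv> tensor_kernel R S \<phi> V"
abbreviation coset where "coset \<equiv> tensor_coset R S \<phi> V"
abbreviation M where "M \<equiv> induced_module R S \<phi> V"
abbreviation tensor (infixl "\<otimes>\<^sub>t" 70) where "s \<otimes>\<^sub>t v \<equiv> pure_tensor R S \<phi> V s v"
abbreviation act where "act s \<equiv> frag_extend (\<lambda>(t, v). frag_of (s \<otimes>\<^bsub>S\<^esub> t, v))"

section \<open>The subgroup of relations and its cosets\<close>

sublocale F: comm_group F
  by (rule abelian_free_Abelian_group)

lemma keys_frag_diff3:
  assumes "x \<in> A" "y \<in> A" "z \<in> A"
  shows "Poly_Mapping.keys (frag_of x - frag_of y - frag_of z) \<subseteq> A"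
  using assms by (intro order_trans[OF keys_diff] Un_least) (auto dest: subsetD[OF keys_diff])

lemma relators_subset: "tensor_relators R S \<phi> V \<subseteq> carrier F"
  unfolding tensor_relators_def
  using ring_hom_closed[OF hom] V.smult_closed
  by (auto simp del: frag_of_nonzero
      dest!: subsetD[OF keys_diff] subsetD[OF keys_frag_diff3[where A = "carrier S \<times> carrier V", rotated -1]])

lemma subgroup_K: "subgroup K F"
  unfolding tensor_kernel_def by (rule F.generate_is_subgroup[OF relators_subset])

lemma normal_K: "K \<lhd> F"
  by (rule F.subgroup_imp_normal[OF subgroup_K])

lemma relator_in_K: "c \<in> tensor_relators R S \<phi> V \<Longrightarrow> c \<in> K"
  unfolding tensor_kernel_def by (rule generate.incl)

lemma K_subset: "c \<in> K \<Longrightarrow> c \<in> carrier F"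
  using subgroup.subset[OF subgroup_K] by blast

lemma K_minus: "c \<in> K \<Longrightarrow> - c \<in> K"
  using subgroup.m_inv_closed[OF subgroup_K, of c] K_subset[of c] by simp

lemma K_add: "\<lbrakk>c \<in> K; d \<in> K\<rbrakk> \<Longrightarrow> c + d \<in> K"
  using subgroup.m_closed[OF subgroup_K, of c d] by simp

lemma coset_eq_image: "coset c = (\<lambda>k. k + c) ` K"
  by (auto simp: tensor_coset_def r_coset_def)

lemma K_zero: "0 \<in> K"
  using subgroup.one_closed[OF subgroup_K] by simp

lemma mem_coset: "d \<in> coset c \<longleftrightarrow> d - c \<in> K"
  by (auto simp: coset_eq_image image_iff) (metis diff_add_cancel)

lemma coset_eq_iff: "coset c = coset d \<longleftrightarrow> c - d \<in> K"
proof
  assume "coset c = coset d"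
  then show "c - d \<in> K" using mem_coset[of c c] mem_coset[of c d] K_zero by simp
next
  assume *: "c - d \<in> K"
  have "e - c \<in> K \<longleftrightarrow> e - d \<in> K" for e
    using K_add[OF _ *, of "e - c"] K_add[OF _ K_minus[OF *], of "e - d"] by auto
  then show "coset c = coset d" by (auto simp: mem_coset)
qed

lemma coset_eqI: "c - d \<in> K \<Longrightarrow> coset c = coset d"
  by (simp add: coset_eq_iff)

text \<open>Fits the two kinds of additivity relators, which have the shape
  \<open>c - d - e\<close>.\<close>

lemma coset_diff_relator:
  assumes "c - d - e \<in> K" "d \<in> carrier F" "e \<in> carrier F"
  shows "coset c = coset (d + e)"
  using assms by (intro coset_eqI) (simp add: diff_diff_eq)

section \<open>The module structure on the quotient\<close>

lemma M_carrier: "carrier M = coset ` carrier F"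
  by (simp add: induced_module_def Let_def carrier_FactGroup tensor_coset_def)

lemma coset_closed: "c \<in> carrier F \<Longrightarrow> coset c \<in> carrier M"
  by (simp add: M_carrier)

lemma M_zero: "\<zero>\<^bsub>M\<^esub> = coset 0"
  by (simp add: induced_module_def Let_def coset_eq_image)

lemma M_add:
  assumes "c \<in> carrier F" "d \<in> carrier F"
  shows "coset c \<oplus>\<^bsub>M\<^esub> coset d = coset (c + d)"
  using normal.rcos_sum[OF normal_K assms] by (simp add: induced_module_def Let_def tensor_coset_def)

lemma act_closed: "\<lbrakk>s \<in> carrier S; c \<in> carrier F\<rbrakk> \<Longrightarrow> act s c \<in> carrier F"
  using keys_frag_extend[of "\<lambda>(t, v). frag_of (s \<otimes>\<^bsub>S\<^esub> t, v)" c] by fastforce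

text \<open>Left multiplication by \<open>s\<close> preserves each kind of relator: distributivity
  serves the first, the second only has its ring entry replaced, and the third needs
  \<open>s (t \<phi>(a)) = (s t) \<phi>(a)\<close>. This is why the action descends to the
  quotient.\<close>

lemma act_relator:
  assumes s: "s \<in> carrier S" and c: "c \<in> tensor_relators R S \<phi> V"
  shows "act s c \<in> tensor_relators R S \<phi> V"
  using c unfolding tensor_relators_def
proof (elim UnE CollectE exE conjE, goal_cases)
  case (1 t u v)
  then show ?case using s
    by (intro UnI1 CollectI exI[of _ "s \<otimes>\<^bsub>S\<^esub> t"] exI[of _ "s \<otimes>\<^bsub>S\<^esub> u"] exI[of _ v])
       (simp add: frag_extend_diff S.r_distr)
next
  case (2 t v w)
  then show ?case using s
    by (intro UnI1 UnI2 CollectI exI[of _ "s \<otimes>\<^bsub>S\<^esub> t"] exI[of _ v] exI[of _ w])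
       (simp add: frag_extend_diff)
next
  case (3 t a v)
  then show ?case using s ring_hom_closed[OF hom]
    by (intro UnI2 CollectI exI[of _ "s \<otimes>\<^bsub>S\<^esub> t"] exI[of _ a] exI[of _ v])
       (simp add: frag_extend_diff S.m_assoc)
qed

lemma act_K:
  assumes s: "s \<in> carrier S" and c: "c \<in> K"
  shows "act s c \<in> K"
  using c unfolding tensor_kernel_def
proof (induction rule: generate.induct)
  case one
  then show ?case by (simp add: generate.one[of F, simplified])
next
  case (incl c)
  then show ?case using act_relator[OF s] by (blast intro: generate.incl)
next
  case (inv c)
  then have "c \<in> carrier F" "act s c \<in> carrier F"
    using relators_subset act_relator[OF s] by blast+
  then have "inv\<^bsub>F\<^esub> c = - c" "inv\<^bsub>F\<^esub> act s c = - act s c"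
    by simp_all
  moreover have "inv\<^bsub>F\<^esub> act s c \<in> generate F (tensor_relators R S \<phi> V)"
    using act_relator[OF s inv] by (rule generate.inv)
  ultimately show ?case by (simp add: frag_extend_minus)
next
  case (eng c d)
  then show ?case using generate.eng[of "act s c" F _ "act s d"] by (simp add: frag_extend_add)
qed

text \<open>Two representatives differ by an element of \<open>K\<close>, which \<open>act s\<close>
  keeps inside \<open>K\<close>. Hence all members of the union in the definition coincide, and the
  union is over a nonempty set.\<close>

lemma M_smult:
  assumes s: "s \<in> carrier S"
  shows "s \<odot>\<^bsub>M\<^esub> coset c = coset (act s c)"
proof -
  have "coset (act s d) = coset (act s c)" if "d \<in> coset c" for d
    using that act_K[OF s, of "d - c"] by (simp add: mem_coset coset_eq_iff frag_extend_diff)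
  moreover have "c \<in> coset c" using K_zero by (simp add: mem_coset)
  ultimately have "(\<Union>d\<in>coset c. coset (act s d)) = coset (act s c)" by blast
  then show ?thesis by (simp add: induced_module_def Let_def)
qed

lemma F_add: "\<lbrakk>c \<in> carrier F; d \<in> carrier F\<rbrakk> \<Longrightarrow> c + d \<in> carrier F"
  using F.m_closed by simp

lemma F_zero: "0 \<in> carrier F"
  by simp

lemma F_minus: "c \<in> carrier F \<Longrightarrow> - c \<in> carrier F"
  by simp

lemma M_cases:
  assumes "u \<in> carrier M"
  obtains c where "c \<in> carrier F" "u = coset c"
  using assms by (auto simp: M_carrier)

lemma abelian_group_M: "abelian_group M"
proof (rule abelian_groupI)
  fix u assume "u \<in> carrier M"
  then obtain c where c: "c \<in> carrier F" "u = coset c" by (rule M_cases)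
  then show "\<exists>v\<in>carrier M. v \<oplus>\<^bsub>M\<^esub> u = \<zero>\<^bsub>M\<^esub>"
    using F_minus[OF c(1)] by (intro bexI[of _ "coset (- c)"]) (simp_all add: M_add M_zero M_carrier)
qed (auto elim!: M_cases simp: M_add M_zero coset_closed F_add F_zero add_ac simp del: carrier_free_Abelian_group_iff)

text \<open>Differences replace sums in the induction because formal sums have integer coefficients:
  closure under differences reaches negative multiples of tensors as well.\<close>

lemma M_induct [consumes 1, case_names zero tensor diff]:
  assumes u: "u \<in> carrier M"
    and zero: "Q \<zero>\<^bsub>M\<^esub>"
    and tensor: "\<And>s v. \<lbrakk>s \<in> carrier S; v \<in> carrier V\<rbrakk> \<Longrightarrow> Q (s \<otimes>\<^sub>t v)"
    and diff: "\<And>u v. \<lbrakk>u \<in> carrier M; v \<in> carrier M; Q u; Q v\<rbrakk> \<Longrightarrow> Q (u \<ominus>\<^bsub>M\<^esub> v)"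
  shows "Q u"
proof -
  interpret M: abelian_group M by (rule abelian_group_M)
  obtain c where c: "c \<in> carrier F" "u = coset c" using u by (rule M_cases)
  have "Poly_Mapping.keys c \<subseteq> carrier S \<times> carrier V" using c by simp
  then have "Q (coset c)"
  proof (induction c rule: free_Abelian_group_induct[consumes 1, case_names zero diff one])
    case (diff x y)
    then have *: "x \<in> carrier F" "y \<in> carrier F" by auto
    have "coset (x - y) \<oplus>\<^bsub>M\<^esub> coset y = coset x"
      using F_add[OF *(1) F_minus[OF *(2)]] * by (simp add: M_add del: carrier_free_Abelian_group_iff)
    moreover have "coset (x - y) \<in> carrier M"
      using F_add[OF *(1) F_minus[OF *(2)]] by (intro coset_closed) simp
    ultimately have "coset (x - y) = coset x \<ominus>\<^bsub>M\<^esub> coset y"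
      using coset_closed[OF *(1)] coset_closed[OF *(2)]
      by (metis M.add.inv_solve_right M.minus_eq)
    then show ?case using assms(4)[OF coset_closed coset_closed] * diff by metis
  qed (use zero tensor in \<open>auto simp: M_zero pure_tensor_def\<close>)
  then show ?thesis using c by simp
qed

text \<open>Apart from the well-definedness of the action, only additivity in the scalar (the second
  goal) needs relators. Additivity in the vector, associativity and the unit law hold already for
  formal sums.\<close>

lemma left_module_M: "left_module S M"
proof -
  interpret M: abelian_group M by (rule abelian_group_M)
  show ?thesis
  proof (unfold_locales, goal_cases)
    case (1 a u)
    then show ?case by (auto elim!: M_cases simp: M_smult act_closed coset_closed simp del: carrier_free_Abelian_group_iff)
  next
    case (2 a b u)
    from 2(3) obtain c where c: "c \<in> carrier F" "u = coset c" by (rule M_cases)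
    have "Poly_Mapping.keys c \<subseteq> carrier S \<times> carrier V" using c by simp
    then have "act (a \<oplus>\<^bsub>S\<^esub> b) c - act a c - act b c \<in> K"
    proof (induction c rule: free_Abelian_group_induct[consumes 1, case_names zero diff one])
      case (diff x y)
      have "act (a \<oplus>\<^bsub>S\<^esub> b) (x - y) - act a (x - y) - act b (x - y) =
          (act (a \<oplus>\<^bsub>S\<^esub> b) x - act a x - act b x) + - (act (a \<oplus>\<^bsub>S\<^esub> b) y - act a y - act b y)"
        by (simp add: frag_extend_diff)
      then show ?case using K_add[OF diff(3) K_minus[OF diff(4)]] by metis
    next
      case (one p)
      then obtain t v where p: "p = (t, v)" "t \<in> carrier S" "v \<in> carrier V" by auto
      then have "frag_of ((a \<oplus>\<^bsub>S\<^esub> b) \<otimes>\<^bsub>S\<^esub> t, v) - frag_of (a \<otimes>\<^bsub>S\<^esub> t, v) - frag_of (b \<otimes>\<^bsub>S\<^esub> t, v)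
          \<in> tensor_relators R S \<phi> V"
        unfolding tensor_relators_def using \<open>a \<in> carrier S\<close> \<open>b \<in> carrier S\<close>
        by (intro UnI1 CollectI exI[of _ "a \<otimes>\<^bsub>S\<^esub> t"] exI[of _ "b \<otimes>\<^bsub>S\<^esub> t"] exI[of _ v])
           (simp add: S.l_distr)
      then show ?case using p by (simp add: relator_in_K)
    qed (simp add: K_zero)
    then have "coset (act (a \<oplus>\<^bsub>S\<^esub> b) c) = coset (act a c + act b c)"
      by (intro coset_eqI) (simp add: diff_diff_eq)
    then show ?case using 2 c by (simp add: M_smult M_add act_closed del: carrier_free_Abelian_group_iff)
  next
    case (3 a u v)
    then show ?case
      by (auto elim!: M_cases simp: M_smult act_closed M_add F_add frag_extend_add simp del: carrier_free_Abelian_group_iff)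
  next
    case (4 a b u)
    from 4(3) obtain c where c: "c \<in> carrier F" "u = coset c" by (rule M_cases)
    have "Poly_Mapping.keys c \<subseteq> carrier S \<times> carrier V" using c by simp
    then have "act (a \<otimes>\<^bsub>S\<^esub> b) c = act a (act b c)"
      using 4 by (induction c rule: free_Abelian_group_induct[consumes 1, case_names zero diff one]) (auto simp: frag_extend_diff S.m_assoc)
    then show ?case using 4 c by (simp add: M_smult)
  next
    case (5 u)
    from 5 obtain c where c: "c \<in> carrier F" "u = coset c" by (rule M_cases)
    have "Poly_Mapping.keys c \<subseteq> carrier S \<times> carrier V" using c by simp
    then have "act \<one>\<^bsub>S\<^esub> c = c"
      by (induction c rule: free_Abelian_group_induct[consumes 1, case_names zero diff one]) (auto simp: frag_extend_diff)
    then show ?case using c by (simp add: M_smult)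
  qed
qed

sublocale M: left_module S M
  by (rule left_module_M)

section \<open>Pure tensors and the universal property\<close>

lemma tensor_closed [simp, intro]: "\<lbrakk>s \<in> carrier S; v \<in> carrier V\<rbrakk> \<Longrightarrow> s \<otimes>\<^sub>t v \<in> carrier M"
  unfolding pure_tensor_def by (rule coset_closed) simp

lemma smult_tensor: "s \<in> carrier S \<Longrightarrow> s \<odot>\<^bsub>M\<^esub> (t \<otimes>\<^sub>t v) = (s \<otimes>\<^bsub>S\<^esub> t) \<otimes>\<^sub>t v"
  by (simp add: pure_tensor_def M_smult)

lemma tensor_add_left:
  assumes "s \<in> carrier S" "t \<in> carrier S" "v \<in> carrier V"
  shows "(s \<oplus>\<^bsub>S\<^esub> t) \<otimes>\<^sub>t v = s \<otimes>\<^sub>t v \<oplus>\<^bsub>M\<^esub> t \<otimes>\<^sub>t v"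
  using assms unfolding pure_tensor_def
  by (subst M_add) (simp_all, rule coset_diff_relator, rule relator_in_K, auto simp: tensor_relators_def)

lemma tensor_add_right:
  assumes "s \<in> carrier S" "v \<in> carrier V" "w \<in> carrier V"
  shows "s \<otimes>\<^sub>t (v \<oplus>\<^bsub>V\<^esub> w) = s \<otimes>\<^sub>t v \<oplus>\<^bsub>M\<^esub> s \<otimes>\<^sub>t w"
  using assms unfolding pure_tensor_def
  by (subst M_add) (simp_all, rule coset_diff_relator, rule relator_in_K, auto simp: tensor_relators_def)

lemma tensor_balanced:
  assumes "s \<in> carrier S" "a \<in> carrier R" "v \<in> carrier V"
  shows "(s \<otimes>\<^bsub>S\<^esub> \<phi> a) \<otimes>\<^sub>t v = s \<otimes>\<^sub>t (a \<odot>\<^bsub>V\<^esub> v)"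
  using assms unfolding pure_tensor_def
  by (auto intro!: coset_eqI relator_in_K simp: tensor_relators_def)

text \<open>The map on pairs extends to the free abelian group. The three hypotheses on
  \<open>f\<close> say exactly that the extension kills the three kinds of relators, so it factors
  through the quotient.\<close>

lemma tensor_universal:
  assumes G: "abelian_group G"
    and closed: "\<And>s v. \<lbrakk>s \<in> carrier S; v \<in> carrier V\<rbrakk> \<Longrightarrow> f s v \<in> carrier G"
    and add_left: "\<And>s t v. \<lbrakk>s \<in> carrier S; t \<in> carrier S; v \<in> carrier V\<rbrakk> \<Longrightarrow>
      f (s \<oplus>\<^bsub>S\<^esub> t) v = f s v \<oplus>\<^bsub>G\<^esub> f t v"
    and add_right: "\<And>s v w. \<lbrakk>s \<in> carrier S; v \<in> carrier V; w \<in> carrier V\<rbrakk> \<Longrightarrow>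
      f s (v \<oplus>\<^bsub>V\<^esub> w) = f s v \<oplus>\<^bsub>G\<^esub> f s w"
    and balanced: "\<And>s a v. \<lbrakk>s \<in> carrier S; a \<in> carrier R; v \<in> carrier V\<rbrakk> \<Longrightarrow>
      f (s \<otimes>\<^bsub>S\<^esub> \<phi> a) v = f s (a \<odot>\<^bsub>V\<^esub> v)"
  obtains h where "\<And>u. u \<in> carrier M \<Longrightarrow> h u \<in> carrier G"
    and "\<And>u v. \<lbrakk>u \<in> carrier M; v \<in> carrier M\<rbrakk> \<Longrightarrow> h (u \<oplus>\<^bsub>M\<^esub> v) = h u \<oplus>\<^bsub>G\<^esub> h v"
    and "\<And>s v. \<lbrakk>s \<in> carrier S; v \<in> carrier V\<rbrakk> \<Longrightarrow> h (s \<otimes>\<^sub>t v) = f s v"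
proof -
  interpret G: abelian_group G by fact
  have "(\<lambda>(s, v). f s v) ` (carrier S \<times> carrier V) \<subseteq> carrier (add_monoid G)"
    using closed by auto
  then obtain h where h: "h \<in> hom F (add_monoid G)"
    and h_of: "\<And>p. p \<in> carrier S \<times> carrier V \<Longrightarrow> h (frag_of p) = (\<lambda>(s, v). f s v) p"
    using comm_group.free_Abelian_group_universal[OF G.a_comm_group] by metis
  interpret h: group_hom F "add_monoid G" h
    using h by unfold_locales
  have h_diff: "h (c - d) = h c \<ominus>\<^bsub>G\<^esub> h d" if "c \<in> carrier F" "d \<in> carrier F" for c d
    using h.hom_mult[OF that(1) F_minus[OF that(2)]] h.hom_inv[OF that(2)] that
    by (simp add: G.minus_eq a_inv_def del: h.hom_mult)
  have F_diff: "c - d \<in> carrier F" if "c \<in> carrier F" "d \<in> carrier F" for c d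
    using F_add[OF that(1) F_minus[OF that(2)]] by simp
  have cancel: "x \<oplus>\<^bsub>G\<^esub> y \<ominus>\<^bsub>G\<^esub> x \<ominus>\<^bsub>G\<^esub> y = \<zero>\<^bsub>G\<^esub>" if "x \<in> carrier G" "y \<in> carrier G" for x y
  proof -
    have "x \<oplus>\<^bsub>G\<^esub> y \<ominus>\<^bsub>G\<^esub> x \<ominus>\<^bsub>G\<^esub> y = (x \<oplus>\<^bsub>G\<^esub> y) \<oplus>\<^bsub>G\<^esub> \<ominus>\<^bsub>G\<^esub> (x \<oplus>\<^bsub>G\<^esub> y)"
      using that by (simp add: G.minus_eq G.minus_add G.a_assoc)
    then show ?thesis using that by (simp add: G.r_neg)
  qed
  have cancel': "x \<ominus>\<^bsub>G\<^esub> x = \<zero>\<^bsub>G\<^esub>" if "x \<in> carrier G" for x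
    using that by (simp add: G.minus_eq G.r_neg)
  have h_rel: "h c = \<zero>\<^bsub>G\<^esub>" if "c \<in> tensor_relators R S \<phi> V" for c
    using that unfolding tensor_relators_def
  proof (elim UnE CollectE exE conjE, goal_cases)
    case (1 s t v)
    then show ?case by (simp add: h_diff F_diff h_of closed add_left cancel frag_of_in_free_Abelian_group
        del: carrier_free_Abelian_group_iff)
  next
    case (2 s v w)
    then show ?case by (simp add: h_diff F_diff h_of closed add_right cancel frag_of_in_free_Abelian_group
        del: carrier_free_Abelian_group_iff)
  next
    case (3 s a v)
    then show ?case using ring_hom_closed[OF hom]
      by (simp add: h_diff F_diff h_of closed balanced cancel' V.smult_closed frag_of_in_free_Abelian_group
          del: carrier_free_Abelian_group_iff)
  qed
  \<comment> \<open>A kernel is a subgroup, so it contains whatever the relators generate as soon as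
    it contains the relators.\<close>
  have "K \<subseteq> kernel F (add_monoid G) h"
    unfolding tensor_kernel_def
    by (rule F.generate_subgroup_incl[OF _ h.subgroup_kernel])
       (use h_rel relators_subset in \<open>auto simp: kernel_def simp del: carrier_free_Abelian_group_iff\<close>)
  then obtain g where g: "g \<in> hom (F Mod K) (add_monoid G)" "\<And>c. c \<in> carrier F \<Longrightarrow> g (K #>\<^bsub>F\<^esub> c) = h c"
    using h.FactGroup_universal_kernel[OF normal_K] by blast
  show thesis
  proof
    show "g u \<in> carrier G" if "u \<in> carrier M" for u
      using that g h.hom_closed by (auto simp: M_carrier tensor_coset_def simp del: carrier_free_Abelian_group_iff)
    show "g (u \<oplus>\<^bsub>M\<^esub> v) = g u \<oplus>\<^bsub>G\<^esub> g v" if "u \<in> carrier M" "v \<in> carrier M" for u v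
      using that hom_mult[OF g(1), of u v] by (simp add: induced_module_def Let_def)
    show "g (s \<otimes>\<^sub>t v) = f s v" if "s \<in> carrier S" "v \<in> carrier V" for s v
      using that g(2)[of "frag_of (s, v)"] h_of by (simp add: pure_tensor_def tensor_coset_def)
  qed
qed

end


section \<open>Coordinates and length in the induced module\<close>

locale induced_laurent = skew_laurent_ring D \<sigma> + V: left_module D V
  for D :: "('a, 'm) ring_scheme" (structure) and \<sigma> and V :: "('a, 'b, 'n) module_scheme"
begin

sublocale T: scalar_extension D L "\<lambda>a. mon a 0" V
  by unfold_locales (rule mon_hom)

abbreviation M where "M \<equiv> laurent_module D \<sigma> V"
abbreviation xt where "xt \<equiv> x_tensor D \<sigma> V"
abbreviation len where "len \<equiv> laurent_length D \<sigma> V"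

lemma M_eq: "T.M = M"
  by (simp add: laurent_module_def)

sublocale M: left_module L M
  using T.left_module_M by (simp add: M_eq)

text \<open>Since \<open>a x\<^sup>i \<otimes> v = x\<^sup>i \<otimes> \<sigma>\<^sup>-\<^sup>i(a) v\<close>, the component of \<open>s \<otimes> v\<close> in degree \<open>i\<close> has the
  coordinate \<open>\<sigma>\<^sup>-\<^sup>i(s\<^sub>i) v\<close>.\<close>

definition coord_map where
  "coord_map i h \<longleftrightarrow> (\<forall>u\<in>carrier M. h u \<in> carrier V) \<and>
     (\<forall>u\<in>carrier M. \<forall>v\<in>carrier M. h (u \<oplus>\<^bsub>M\<^esub> v) = h u \<oplus>\<^bsub>V\<^esub> h v) \<and>
     (\<forall>s\<in>carrier L. \<forall>v\<in>carrier V.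
        h (pure_tensor D L (\<lambda>a. mon a 0) V s v) = P (- i) (s i) \<odot>\<^bsub>V\<^esub> v)"

text \<open>Since pure tensors generate the module, the conditions determine the map on the carrier;
  the choice affects only values outside it.\<close>

definition coord where "coord i = (SOME h. coord_map i h)"

lemma coord_map_coord: "coord_map i (coord i)"
proof -
  obtain h where "\<And>u. u \<in> carrier T.M \<Longrightarrow> h u \<in> carrier V"
    "\<And>u v. \<lbrakk>u \<in> carrier T.M; v \<in> carrier T.M\<rbrakk> \<Longrightarrow> h (u \<oplus>\<^bsub>T.M\<^esub> v) = h u \<oplus>\<^bsub>V\<^esub> h v"
    "\<And>s v. \<lbrakk>s \<in> carrier L; v \<in> carrier V\<rbrakk> \<Longrightarrow>
       h (pure_tensor D L (\<lambda>a. mon a 0) V s v) = P (- i) (s i) \<odot>\<^bsub>V\<^esub> v"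
  proof (rule T.tensor_universal[OF V.M.abelian_group_axioms, of "\<lambda>s v. P (- i) (s i) \<odot>\<^bsub>V\<^esub> v"], goal_cases)
    \<comment> \<open>Balancing: the coefficient of \<open>s a\<close> in degree \<open>i\<close> is
      \<open>s i\<close> times \<open>\<sigma>^i(a)\<close>, and the twist by
      \<open>\<sigma>^-i\<close> in the coordinate restores \<open>a\<close> itself.\<close>
    case (4 s a v)
    then show ?case
      by (simp add: mult_mon_0 P_mult laurent_closed V.smult_assoc)
  qed (auto simp: V.smult_closed V.smult_l_distr V.smult_r_distr laurent_closed laurent_add P_add)
  then have "coord_map i h" by (simp add: coord_map_def M_eq)
  then show ?thesis unfolding coord_def by (rule someI[of "coord_map i"])
qed

lemma coord_closed [simp, intro]: "u \<in> carrier M \<Longrightarrow> coord i u \<in> carrier V"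
  using coord_map_coord[of i] by (simp add: coord_map_def)

lemma coord_add:
  "\<lbrakk>u \<in> carrier M; v \<in> carrier M\<rbrakk> \<Longrightarrow> coord i (u \<oplus>\<^bsub>M\<^esub> v) = coord i u \<oplus>\<^bsub>V\<^esub> coord i v"
  using coord_map_coord[of i] by (simp add: coord_map_def)

lemma coord_tensor:
  "\<lbrakk>s \<in> carrier L; v \<in> carrier V\<rbrakk> \<Longrightarrow>
    coord i (pure_tensor D L (\<lambda>a. mon a 0) V s v) = P (- i) (s i) \<odot>\<^bsub>V\<^esub> v"
  using coord_map_coord[of i] by (simp add: coord_map_def)

lemma coord_zero [simp]: "coord i \<zero>\<^bsub>M\<^esub> = \<zero>\<^bsub>V\<^esub>"
  by (rule additive_zero[OF M.M.abelian_group_axioms V.M.abelian_group_axioms]) (auto simp: coord_add)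

lemma coord_diff:
  "\<lbrakk>u \<in> carrier M; v \<in> carrier M\<rbrakk> \<Longrightarrow> coord i (u \<ominus>\<^bsub>M\<^esub> v) = coord i u \<ominus>\<^bsub>V\<^esub> coord i v"
  by (rule additive_diff[OF M.M.abelian_group_axioms V.M.abelian_group_axioms]) (auto simp: coord_add)

text \<open>On \<open>s \<otimes> v\<close> the new coefficient in degree \<open>i\<close> is
  \<open>a \<sigma>^k(s (i - k))\<close>; applying \<open>\<sigma>^-i\<close> leaves the twist
  \<open>-(i - k)\<close> on the old coefficient, as its old degree requires. This formula carries
  all later computations with scalars.\<close>

lemma coord_smult_mon:
  assumes a: "a \<in> carrier D" and u: "u \<in> carrier M"
  shows "coord i (mon a k \<odot>\<^bsub>M\<^esub> u) = P (- i) a \<odot>\<^bsub>V\<^esub> coord (i - k) u"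
  using u[folded M_eq]
proof (induction rule: T.M_induct)
  case zero
  then show ?case using a by (simp add: M_eq M.smult_r_null V.smult_r_null)
next
  case (tensor s v)
  have "coord i (mon a k \<odot>\<^bsub>M\<^esub> pure_tensor D L (\<lambda>a. mon a 0) V s v) = P (- i) ((mon a k \<otimes>\<^bsub>L\<^esub> s) i) \<odot>\<^bsub>V\<^esub> v"
    using a tensor L.m_closed by (simp add: T.smult_tensor[unfolded M_eq] coord_tensor)
  also have "\<dots> = P (- i) a \<odot>\<^bsub>V\<^esub> (P (- (i - k)) (s (i - k)) \<odot>\<^bsub>V\<^esub> v)"
    using a tensor by (simp add: mon_mult laurent_closed P_mult P_P V.smult_assoc)
  finally show ?case using tensor by (simp add: coord_tensor)
next
  case (diff u v)
  then show ?case
    using a by (simp add: M_eq M.smult_r_diff V.smult_r_diff coord_diff M.smult_closed)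
qed

section \<open>Homogeneous tensors and expansion in coordinates\<close>

lemma xt_closed [simp, intro]: "v \<in> carrier V \<Longrightarrow> xt i v \<in> carrier M"
  using T.tensor_closed[of "mon \<one> i" v] by (simp add: x_tensor_def M_eq)

lemma xt_add: "\<lbrakk>v \<in> carrier V; w \<in> carrier V\<rbrakk> \<Longrightarrow> xt i (v \<oplus>\<^bsub>V\<^esub> w) = xt i v \<oplus>\<^bsub>M\<^esub> xt i w"
  using T.tensor_add_right[of "mon \<one> i" v w] by (simp add: x_tensor_def M_eq)

lemma xt_zero [simp]: "xt i \<zero>\<^bsub>V\<^esub> = \<zero>\<^bsub>M\<^esub>"
  by (rule additive_zero[OF V.M.abelian_group_axioms M.M.abelian_group_axioms]) (auto simp: xt_add)

lemma coord_xt: "v \<in> carrier V \<Longrightarrow> coord j (xt i v) = (if j = i then v else \<zero>\<^bsub>V\<^esub>)"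
  by (simp add: x_tensor_def coord_tensor) (simp add: laurent_monom_def V.smult_one V.smult_l_null)

text \<open>Since \<open>a x^i = x^i \<sigma>^-i(a)\<close>, the scalar can be moved across the
  tensor sign.\<close>

lemma mon_tensor:
  assumes "a \<in> carrier D" "v \<in> carrier V"
  shows "pure_tensor D L (\<lambda>a. mon a 0) V (mon a i) v = xt i (P (- i) a \<odot>\<^bsub>V\<^esub> v)"
  using assms T.tensor_balanced[of "mon \<one> i" "P (- i) a" v] by (simp add: x_tensor_def mon_mult_mon)

lemma finsum_xt_mono_neutral:
  assumes "u \<in> carrier M" "finite B" "A \<subseteq> B" "\<forall>i. i \<notin> A \<longrightarrow> coord i u = \<zero>\<^bsub>V\<^esub>"
  shows "(\<Oplus>\<^bsub>M\<^esub>i\<in>A. xt i (coord i u)) = (\<Oplus>\<^bsub>M\<^esub>i\<in>B. xt i (coord i u))"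
  by (rule M.M.add.finprod_mono_neutral_cong_left) (use assms in auto)

text \<open>Induction on the generation by tensors. The index set is some finite set covering the
  support, not the support itself, because supports behave badly under differences.\<close>

lemma coord_expansion_ex:
  assumes u: "u \<in> carrier M"
  obtains A where "finite A" "\<forall>i. i \<notin> A \<longrightarrow> coord i u = \<zero>\<^bsub>V\<^esub>"
    "u = (\<Oplus>\<^bsub>M\<^esub>i\<in>A. xt i (coord i u))"
proof -
  have "\<exists>A. finite A \<and> (\<forall>i. i \<notin> A \<longrightarrow> coord i u = \<zero>\<^bsub>V\<^esub>) \<and> u = (\<Oplus>\<^bsub>M\<^esub>i\<in>A. xt i (coord i u))"
    using u[folded M_eq]
  proof (induction rule: T.M_induct)
    case zero
    then show ?case by (intro exI[of _ "{}"]) (simp add: M_eq)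
  next
    case (tensor s v)
    let ?t = "\<lambda>s. pure_tensor D L (\<lambda>a. mon a 0) V s v"
    obtain A where A: "finite A" "\<forall>i. i \<notin> A \<longrightarrow> s i = \<zero>" using laurent_support[OF tensor(1)] by metis
    have t_closed: "?t r \<in> carrier M" if "r \<in> carrier L" for r
      using T.tensor_closed[OF that tensor(2)] by (simp add: M_eq)
    have t_add: "?t (r \<oplus>\<^bsub>L\<^esub> r') = ?t r \<oplus>\<^bsub>M\<^esub> ?t r'" if "r \<in> carrier L" "r' \<in> carrier L" for r r'
      using T.tensor_add_left[OF that tensor(2)] by (simp add: M_eq)
    have "?t s = ?t (\<Oplus>\<^bsub>L\<^esub>i\<in>A. mon (s i) i)"
      by (rule arg_cong[where f = ?t, OF laurent_eq_finsum[OF tensor(1) A]])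
    also have "\<dots> = (\<Oplus>\<^bsub>M\<^esub>i\<in>A. ?t (mon (s i) i))"
      by (rule finsum_hom[OF L.abelian_monoid_axioms M.M.abelian_monoid_axioms])
         (use tensor in \<open>auto intro!: t_closed t_add additive_zero[OF L.abelian_group_axioms M.M.abelian_group_axioms]
            simp: laurent_closed\<close>)
    also have "\<dots> = (\<Oplus>\<^bsub>M\<^esub>i\<in>A. xt i (coord i (?t s)))"
      using tensor by (intro M.M.finsum_cong') (auto simp: mon_tensor coord_tensor laurent_closed V.smult_closed)
    finally have "?t s = (\<Oplus>\<^bsub>M\<^esub>i\<in>A. xt i (coord i (?t s)))" .
    moreover have "\<forall>i. i \<notin> A \<longrightarrow> coord i (?t s) = \<zero>\<^bsub>V\<^esub>"
      using A tensor by (simp add: coord_tensor V.smult_l_null)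
    ultimately show ?case using A(1) by blast
  next
    case (diff u v)
    from diff(3) obtain A where A: "finite A" "\<forall>i. i \<notin> A \<longrightarrow> coord i u = \<zero>\<^bsub>V\<^esub>"
      "(\<Oplus>\<^bsub>M\<^esub>i\<in>A. xt i (coord i u)) = u" by metis
    from diff(4) obtain B where B: "finite B" "\<forall>i. i \<notin> B \<longrightarrow> coord i v = \<zero>\<^bsub>V\<^esub>"
      "(\<Oplus>\<^bsub>M\<^esub>i\<in>B. xt i (coord i v)) = v" by metis
    \<comment> \<open>Expanding over one common index set is an additive operation, so the elements
      equal to their expansion are closed under differences. Enlarging \<open>A\<close> and
      \<open>B\<close> to the union only adds zero terms.\<close>
    let ?h = "\<lambda>u. \<Oplus>\<^bsub>M\<^esub>i\<in>A \<union> B. xt i (coord i u)"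
    have uv: "u \<in> carrier M" "v \<in> carrier M" using diff by (simp_all add: M_eq)
    have "?h u = u" using finsum_xt_mono_neutral[OF uv(1) _ _ A(2), of "A \<union> B"] A B by simp
    moreover have "?h v = v" using finsum_xt_mono_neutral[OF uv(2) _ _ B(2), of "A \<union> B"] A B by simp
    moreover have "?h (u \<ominus>\<^bsub>M\<^esub> v) = ?h u \<ominus>\<^bsub>M\<^esub> ?h v"
    proof (rule additive_diff[OF M.M.abelian_group_axioms M.M.abelian_group_axioms _ _ uv])
      show "?h x \<in> carrier M" if "x \<in> carrier M" for x
        using that by (intro M.M.finsum_closed) auto
      fix x y assume xy: "x \<in> carrier M" "y \<in> carrier M"
      then have "?h (x \<oplus>\<^bsub>M\<^esub> y) = (\<Oplus>\<^bsub>M\<^esub>i\<in>A \<union> B. xt i (coord i x) \<oplus>\<^bsub>M\<^esub> xt i (coord i y))"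
        by (intro M.M.finsum_cong') (auto simp: coord_add xt_add)
      also have "\<dots> = ?h x \<oplus>\<^bsub>M\<^esub> ?h y"
        using xy by (intro M.M.finsum_addf) auto
      finally show "?h (x \<oplus>\<^bsub>M\<^esub> y) = ?h x \<oplus>\<^bsub>M\<^esub> ?h y" .
    qed
    moreover have "\<forall>i. i \<notin> A \<union> B \<longrightarrow> coord i (u \<ominus>\<^bsub>M\<^esub> v) = \<zero>\<^bsub>V\<^esub>"
      using A(2) B(2) uv by (simp add: coord_diff V.M.minus_eq)
    ultimately show ?case using A(1) B(1)
      by (intro exI[of _ "A \<union> B"]) (simp add: M_eq)
  qed
  then show thesis using that by blast
qed

lemma finite_coord: "u \<in> carrier M \<Longrightarrow> finite {i. coord i u \<noteq> \<zero>\<^bsub>V\<^esub>}"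
  by (rule coord_expansion_ex) (auto elim!: rev_finite_subset)

lemma coord_expansion:
  assumes u: "u \<in> carrier M" and A: "finite A" "\<forall>i. i \<notin> A \<longrightarrow> coord i u = \<zero>\<^bsub>V\<^esub>"
  shows "u = (\<Oplus>\<^bsub>M\<^esub>i\<in>A. xt i (coord i u))"
proof -
  obtain B where B: "finite B" "\<forall>i. i \<notin> B \<longrightarrow> coord i u = \<zero>\<^bsub>V\<^esub>" "u = (\<Oplus>\<^bsub>M\<^esub>i\<in>B. xt i (coord i u))"
    using coord_expansion_ex[OF u] .
  have "(\<Oplus>\<^bsub>M\<^esub>i\<in>B. xt i (coord i u)) = (\<Oplus>\<^bsub>M\<^esub>i\<in>A \<union> B. xt i (coord i u))"
    using A B by (intro finsum_xt_mono_neutral[OF u]) auto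
  also have "\<dots> = (\<Oplus>\<^bsub>M\<^esub>i\<in>A. xt i (coord i u))"
    using A B by (intro finsum_xt_mono_neutral[OF u, symmetric]) auto
  finally show ?thesis using B by simp
qed

lemma coord_eq_zero:
  assumes "u \<in> carrier M" "\<And>i. coord i u = \<zero>\<^bsub>V\<^esub>"
  shows "u = \<zero>\<^bsub>M\<^esub>"
  using coord_expansion[OF assms(1), of "{}"] assms(2) by simp

text \<open>Uniqueness of the expansion: the coordinate maps recover the coefficients from any sum
  of homogeneous tensors. Both definite descriptions, of components and of length, rest on
  it.\<close>

lemma coord_finsum:
  assumes A: "finite A" and w: "\<And>i. i \<in> A \<Longrightarrow> w i \<in> carrier V"
  shows "coord j (\<Oplus>\<^bsub>M\<^esub>i\<in>A. xt i (w i)) = (if j \<in> A then w j else \<zero>\<^bsub>V\<^esub>)"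
proof -
  have "coord j (\<Oplus>\<^bsub>M\<^esub>i\<in>A. xt i (w i)) = (\<Oplus>\<^bsub>V\<^esub>i\<in>A. coord j (xt i (w i)))"
    by (rule finsum_hom[OF M.M.abelian_monoid_axioms V.M.abelian_monoid_axioms]) (use w in \<open>auto simp: coord_add\<close>)
  also have "\<dots> = (if j \<in> A then w j else \<zero>\<^bsub>V\<^esub>)"
  proof (cases "j \<in> A")
    case True
    then have "(\<Oplus>\<^bsub>V\<^esub>i\<in>A. coord j (xt i (w i))) = coord j (xt j (w j))"
      using A w by (intro V.M.finsum_single) (auto simp: coord_xt)
    with True w show ?thesis by (simp add: coord_xt)
  next
    case False
    then have "(\<Oplus>\<^bsub>V\<^esub>i\<in>A. coord j (xt i (w i))) = \<zero>\<^bsub>V\<^esub>"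
      using w by (intro V.M.add.finprod_one_eqI) (auto simp: coord_xt)
    with False show ?thesis by simp
  qed
  finally show ?thesis .
qed

text \<open>The expansion over the support is one decomposition. Any other has the form
  \<open>x^i \<otimes> w i\<close>, and \<open>coord_finsum\<close> forces its terms; outside its
  support the term and the coordinate are both zero.\<close>

lemma homogeneous_component_eq:
  assumes u: "u \<in> carrier M"
  shows "homogeneous_component M (laurent_module_grading D \<sigma> V) u i = xt i (coord i u)"
proof -
  have xt_0: "xt i (coord i u) = \<zero>\<^bsub>M\<^esub> \<longleftrightarrow> coord i u = \<zero>\<^bsub>V\<^esub>" for i
    using coord_xt[of "coord i u" i i] u by auto
  have "homogeneous_component M (laurent_module_grading D \<sigma> V) u = (\<lambda>i. xt i (coord i u))"
    unfolding homogeneous_component_def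
  proof (rule the_equality)
    show "(\<forall>i. xt i (coord i u) \<in> laurent_module_grading D \<sigma> V i) \<and>
        finite {i. xt i (coord i u) \<noteq> \<zero>\<^bsub>M\<^esub>} \<and>
        u = (\<Oplus>\<^bsub>M\<^esub>i\<in>{i. xt i (coord i u) \<noteq> \<zero>\<^bsub>M\<^esub>}. xt i (coord i u))"
    proof (intro conjI)
      show "u = (\<Oplus>\<^bsub>M\<^esub>i\<in>{i. xt i (coord i u) \<noteq> \<zero>\<^bsub>M\<^esub>}. xt i (coord i u))"
        unfolding xt_0 using finite_coord[OF u] by (intro coord_expansion[OF u]) auto
    qed (use u finite_coord[OF u] in \<open>auto simp: laurent_module_grading_def xt_0\<close>)
  next
    fix c assume c: "(\<forall>i. c i \<in> laurent_module_grading D \<sigma> V i) \<and> finite {i. c i \<noteq> \<zero>\<^bsub>M\<^esub>} \<and>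
        u = (\<Oplus>\<^bsub>M\<^esub>i\<in>{i. c i \<noteq> \<zero>\<^bsub>M\<^esub>}. c i)"
    then have "\<forall>i. \<exists>v. c i = xt i v \<and> v \<in> carrier V" by (auto simp: laurent_module_grading_def)
    then obtain w where w: "\<And>i. c i = xt i (w i)" "\<And>i. w i \<in> carrier V" by metis
    show "c = (\<lambda>i. xt i (coord i u))"
    proof
      fix j
      have "coord j u = (if j \<in> {i. c i \<noteq> \<zero>\<^bsub>M\<^esub>} then w j else \<zero>\<^bsub>V\<^esub>)"
        using c coord_finsum[of "{i. c i \<noteq> \<zero>\<^bsub>M\<^esub>}" w j] w by simp
      then show "c j = xt j (coord j u)" using w(1)[of j] by auto
    qed
  qed
  then show ?thesis by simp
qed

section \<open>Lowest and highest degree, and the length\<close>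

definition spans where
  "spans u m n \<longleftrightarrow> coord m u \<noteq> \<zero>\<^bsub>V\<^esub> \<and> coord n u \<noteq> \<zero>\<^bsub>V\<^esub> \<and> (\<forall>i. i \<notin> {m..n} \<longrightarrow> coord i u = \<zero>\<^bsub>V\<^esub>)"

lemma spans_ex:
  assumes u: "u \<in> carrier M" "u \<noteq> \<zero>\<^bsub>M\<^esub>"
  obtains m n where "spans u m n"
proof -
  let ?S = "{i. coord i u \<noteq> \<zero>\<^bsub>V\<^esub>}"
  have S: "finite ?S" "?S \<noteq> {}" using finite_coord[OF u(1)] coord_eq_zero[OF u(1)] u(2) by auto
  have "spans u (Min ?S) (Max ?S)"
    unfolding spans_def using Min_in[OF S] Max_in[OF S] Min_le[OF S(1)] Max_ge[OF S(1)] by auto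
  then show thesis by (rule that)
qed

lemma spans_le: "spans u m n \<Longrightarrow> m \<le> n"
  unfolding spans_def by (metis atLeastAtMost_iff order_refl)

lemma length_eq:
  assumes u: "u \<in> carrier M" and s: "spans u m n"
  shows "len u = nat (n - m)"
  unfolding laurent_length_def
proof (rule the_equality)
  show "\<exists>m' n' w. m' \<le> n' \<and> (\<forall>i\<in>{m'..n'}. w i \<in> carrier V) \<and> w m' \<noteq> \<zero>\<^bsub>V\<^esub> \<and> w n' \<noteq> \<zero>\<^bsub>V\<^esub> \<and>
      u = (\<Oplus>\<^bsub>M\<^esub>i\<in>{m'..n'}. xt i (w i)) \<and> nat (n - m) = nat (n' - m')"
  proof (rule exI[of _ m], rule exI[of _ n], rule exI[of _ "\<lambda>i. coord i u"], intro conjI)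
    show "u = (\<Oplus>\<^bsub>M\<^esub>i\<in>{m..n}. xt i (coord i u))"
      using s by (intro coord_expansion[OF u]) (auto simp: spans_def)
  qed (use u s spans_le[OF s] in \<open>auto simp: spans_def\<close>)
next
  fix l assume "\<exists>m' n' w. m' \<le> n' \<and> (\<forall>i\<in>{m'..n'}. w i \<in> carrier V) \<and> w m' \<noteq> \<zero>\<^bsub>V\<^esub> \<and> w n' \<noteq> \<zero>\<^bsub>V\<^esub> \<and>
      u = (\<Oplus>\<^bsub>M\<^esub>i\<in>{m'..n'}. xt i (w i)) \<and> l = nat (n' - m')"
  then obtain m' n' w where w: "m' \<le> n'" "\<forall>i\<in>{m'..n'}. w i \<in> carrier V" "w m' \<noteq> \<zero>\<^bsub>V\<^esub>" "w n' \<noteq> \<zero>\<^bsub>V\<^esub>"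
    "u = (\<Oplus>\<^bsub>M\<^esub>i\<in>{m'..n'}. xt i (w i))" "l = nat (n' - m')" by (elim exE conjE)
  have "coord j u = (if j \<in> {m'..n'} then w j else \<zero>\<^bsub>V\<^esub>)" for j
    unfolding w(5) using w(2) by (intro coord_finsum) auto
  then have "spans u m' n'" using w(1-4) by (simp add: spans_def)
  \<comment> \<open>Each of the two intervals contains the endpoints of the other, so they are
    equal.\<close>
  have sub: "{i, j} \<subseteq> {m'..n'}" if "spans u i j" "spans u m' n'" for i j m' n'
    using that unfolding spans_def by blast
  have "m = m'" "n = n'"
    using sub[OF s \<open>spans u m' n'\<close>] sub[OF \<open>spans u m' n'\<close> s] by auto
  then show "l = nat (n - m)" using w(6) by simp
qed

text \<open>The support lies in the degrees \<open>m\<close> to \<open>n - 1\<close>; the excluded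
  top degree \<open>n\<close> is what makes the inequality strict. It is the form met after a
  leading component has been cancelled.\<close>

lemma length_less:
  assumes u: "u \<in> carrier M" "u \<noteq> \<zero>\<^bsub>M\<^esub>" and z: "\<And>i. i < m \<or> n \<le> i \<Longrightarrow> coord i u = \<zero>\<^bsub>V\<^esub>"
  shows "len u < nat (n - m)"
proof -
  obtain m' n' where s: "spans u m' n'" using spans_ex[OF u] .
  then have "\<not> m' < m" "\<not> n \<le> n'" using z unfolding spans_def by blast+
  then show ?thesis unfolding length_eq[OF u(1) s] using spans_le[OF s] by linarith
qed


text \<open>Translates annihilators in degree 0 into \<open>V\<close>: the same \<open>a\<close>
  tests the coordinate in degree \<open>i\<close> through \<open>\<sigma>^-i(a)\<close>.\<close>

lemma smult_mon_zero_iff: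
  assumes "a \<in> carrier D" "u \<in> carrier M"
  shows "mon a 0 \<odot>\<^bsub>M\<^esub> u = \<zero>\<^bsub>M\<^esub> \<longleftrightarrow> (\<forall>i. P (- i) a \<odot>\<^bsub>V\<^esub> coord i u = \<zero>\<^bsub>V\<^esub>)"
proof -
  have "P (- i) a \<odot>\<^bsub>V\<^esub> coord i u = coord i (mon a 0 \<odot>\<^bsub>M\<^esub> u)" for i
    using assms by (simp add: coord_smult_mon)
  then show ?thesis
    using coord_eq_zero[OF M.smult_closed[OF mon_closed[OF assms(1)] assms(2)]] by auto
qed

section \<open>Elements of minimal length\<close>

lemma minimal_length_iff:
  "u \<in> minimal_length_elements D \<sigma> V N \<longleftrightarrow>
    u \<in> N \<and> u \<noteq> \<zero>\<^bsub>M\<^esub> \<and> (\<forall>v\<in>N. v \<noteq> \<zero>\<^bsub>M\<^esub> \<longrightarrow> len u \<le> len v)"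
proof -
  let ?Q = "\<lambda>l. \<exists>v\<in>N. v \<noteq> \<zero>\<^bsub>M\<^esub> \<and> l = len v"
  have "len u = (LEAST l. ?Q l) \<longleftrightarrow> (\<forall>v\<in>N. v \<noteq> \<zero>\<^bsub>M\<^esub> \<longrightarrow> len u \<le> len v)" if "u \<in> N" "u \<noteq> \<zero>\<^bsub>M\<^esub>"
  proof
    assume "len u = (LEAST l. ?Q l)"
    then show "\<forall>v\<in>N. v \<noteq> \<zero>\<^bsub>M\<^esub> \<longrightarrow> len u \<le> len v" by (auto intro: Least_le)
  next
    assume "\<forall>v\<in>N. v \<noteq> \<zero>\<^bsub>M\<^esub> \<longrightarrow> len u \<le> len v"
    with that show "len u = (LEAST l. ?Q l)" by (intro Least_equality[symmetric]) auto
  qed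
  then show ?thesis unfolding minimal_length_elements_def by blast
qed

lemma minimal_length_ex:
  assumes N: "submodule N L M" "N \<noteq> {\<zero>\<^bsub>M\<^esub>}"
  shows "minimal_length_elements D \<sigma> V N \<noteq> {}"
proof -
  obtain u where "u \<in> N \<and> u \<noteq> \<zero>\<^bsub>M\<^esub>" using N M.submodule_zero[OF N(1)] by blast
  then obtain u where "u \<in> N \<and> u \<noteq> \<zero>\<^bsub>M\<^esub>" "\<forall>v. v \<in> N \<and> v \<noteq> \<zero>\<^bsub>M\<^esub> \<longrightarrow> len u \<le> len v"
    using ex_has_least_nat[of "\<lambda>v. v \<in> N \<and> v \<noteq> \<zero>\<^bsub>M\<^esub>" u len] by blast
  then have "u \<in> minimal_length_elements D \<sigma> V N" by (simp add: minimal_length_iff)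
  then show ?thesis by blast
qed

text \<open>Minimality as a vanishing criterion: a nonzero \<open>w\<close> confined to the degrees
  from \<open>m\<close> to \<open>n - 1\<close> would be shorter than \<open>u\<close>.\<close>

lemma minimal_length_shorter:
  assumes N: "submodule N L M" and u: "u \<in> minimal_length_elements D \<sigma> V N" "spans u m n"
    and w: "w \<in> N" "\<And>i. i < m \<or> n \<le> i \<Longrightarrow> coord i w = \<zero>\<^bsub>V\<^esub>"
  shows "w = \<zero>\<^bsub>M\<^esub>"
proof (rule ccontr)
  assume "w \<noteq> \<zero>\<^bsub>M\<^esub>"
  then have "len w < nat (n - m)" "len u \<le> len w"
    using length_less[OF M.submodule_carrier[OF N w(1)] _ w(2)] u(1) w(1) by (auto simp: minimal_length_iff)
  moreover have "len u = nat (n - m)"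
    using length_eq[OF M.submodule_carrier[OF N] u(2)] u(1) by (simp add: minimal_length_iff)
  ultimately show False by simp
qed

end


section \<open>Modules induced from a simple module\<close>

locale simple_induced_laurent = skew_laurent_ring D \<sigma> + V: simple_module D V
  for D :: "('a, 'm) ring_scheme" (structure) and \<sigma> and V :: "('a, 'b, 'n) module_scheme"
begin

sublocale induced_laurent D \<sigma> V ..

lemma cancel_leading:
  assumes u: "u \<in> carrier M" and v: "v \<in> carrier M" "coord k v \<noteq> \<zero>\<^bsub>V\<^esub>"
  obtains a where "a \<in> carrier D" "coord n (u \<ominus>\<^bsub>M\<^esub> mon a (n - k) \<odot>\<^bsub>M\<^esub> v) = \<zero>\<^bsub>V\<^esub>"
proof -
  obtain b where b: "b \<in> carrier D" "b \<odot>\<^bsub>V\<^esub> coord k v = coord n u"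
    using V.smult_transitive[OF coord_closed[OF v(1)] v(2) coord_closed[OF u]] .
  show thesis
  proof
    \<comment> \<open>In degree \<open>n\<close> a scalar \<open>a\<close> acts through
      \<open>\<sigma>^-n(a)\<close>, so acting as \<open>b\<close> there requires
      \<open>a = \<sigma>^n(b)\<close>.\<close>
    show "P n b \<in> carrier D" using b by simp
    show "coord n (u \<ominus>\<^bsub>M\<^esub> mon (P n b) (n - k) \<odot>\<^bsub>M\<^esub> v) = \<zero>\<^bsub>V\<^esub>"
      using b u v by (simp add: coord_diff coord_smult_mon M.smult_closed V.M.minus_eq V.M.r_neg)
  qed
qed

text \<open>Induction on the length of \<open>u\<close>, each round removing its leading component.
  The dividend may be zero, so that the result applies to every element of a submodule.\<close>

lemma division:
  assumes v: "v \<in> carrier M" "v \<noteq> \<zero>\<^bsub>M\<^esub>"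
  shows "u \<in> carrier M \<Longrightarrow>
    \<exists>q\<in>carrier L. \<exists>r\<in>carrier M. u = q \<odot>\<^bsub>M\<^esub> v \<oplus>\<^bsub>M\<^esub> r \<and> (r = \<zero>\<^bsub>M\<^esub> \<or> len r < len v)"
proof (induction "len u" arbitrary: u rule: less_induct)
  case less
  note u = \<open>u \<in> carrier M\<close>
  show ?case
  proof (cases "u = \<zero>\<^bsub>M\<^esub> \<or> len u < len v")
    case True
    then show ?thesis using u v
      by (intro bexI[of _ "\<zero>\<^bsub>L\<^esub>"] bexI[of _ u]) (auto simp: M.smult_l_null)
  next
    case False
    then obtain m n where s: "spans u m n" using spans_ex[OF u] by blast
    obtain m' n' where s': "spans v m' n'" using spans_ex[OF v] .
    \<comment> \<open>This keeps the lowest degree \<open>m' + (n - n')\<close> of the shifted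
      \<open>v\<close> at or above \<open>m\<close>, so the subtraction creates nothing below the
      support of \<open>u\<close>.\<close>
    have le: "n' - m' \<le> n - m"
      using False length_eq[OF u s] length_eq[OF v(1) s'] spans_le[OF s] spans_le[OF s'] by auto
    obtain a where a: "a \<in> carrier D" "coord n (u \<ominus>\<^bsub>M\<^esub> mon a (n - n') \<odot>\<^bsub>M\<^esub> v) = \<zero>\<^bsub>V\<^esub>"
      using cancel_leading[OF u v(1)] s' unfolding spans_def by metis
    define u' where "u' = u \<ominus>\<^bsub>M\<^esub> mon a (n - n') \<odot>\<^bsub>M\<^esub> v"
    have av: "mon a (n - n') \<odot>\<^bsub>M\<^esub> v \<in> carrier M" using a v by (simp add: M.smult_closed)
    then have u': "u' \<in> carrier M" using u by (simp add: u'_def)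
    have u_eq: "u = mon a (n - n') \<odot>\<^bsub>M\<^esub> v \<oplus>\<^bsub>M\<^esub> u'"
      using M.diff_eq_iff[OF u av u'] by (simp add: u'_def)
    have z: "coord i u' = \<zero>\<^bsub>V\<^esub>" if "i < m \<or> n \<le> i" for i
    proof (cases "i = n")
      case True
      then show ?thesis using a by (simp add: u'_def)
    next
      case False
      with that have "i \<notin> {m..n}" "i - (n - n') \<notin> {m'..n'}" using le by auto
      then have "coord i u = \<zero>\<^bsub>V\<^esub>" "coord (i - (n - n')) v = \<zero>\<^bsub>V\<^esub>"
        using s s' unfolding spans_def by blast+
      then show ?thesis
        using a u v by (simp add: u'_def coord_diff av coord_smult_mon V.smult_r_null V.M.minus_eq)
    qed
    \<comment> \<open>Zero is split off because its length is unspecified, so the induction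
      hypothesis cannot be reached for it.\<close>
    show ?thesis
    proof (cases "u' = \<zero>\<^bsub>M\<^esub>")
      case True
      then show ?thesis using u_eq a by (intro bexI[of _ "mon a (n - n')"] bexI[of _ u']) auto
    next
      case nonzero: False
      have "len u' < len u" using length_less[OF u' nonzero z] length_eq[OF u s] by simp
      from less.hyps[OF this u'] obtain q r where qr: "q \<in> carrier L" "r \<in> carrier M"
        "u' = q \<odot>\<^bsub>M\<^esub> v \<oplus>\<^bsub>M\<^esub> r" "r = \<zero>\<^bsub>M\<^esub> \<or> len r < len v" by blast
      have "u = (mon a (n - n') \<oplus>\<^bsub>L\<^esub> q) \<odot>\<^bsub>M\<^esub> v \<oplus>\<^bsub>M\<^esub> r"
        using u_eq qr(1-3) a v av by (simp add: M.smult_l_distr M.smult_closed M.M.a_assoc)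
      then show ?thesis using qr a by (intro bexI[of _ "mon a (n - n') \<oplus>\<^bsub>L\<^esub> q"] bexI[of _ r]) auto
    qed
  qed
qed

lemma euclidean: "euclidean_module L M len"
  by unfold_locales (use division in auto)

text \<open>The remainder on division by \<open>u\<close> stays in \<open>N\<close>, being a
  difference of elements of \<open>N\<close>; a nonzero one would be shorter than
  \<open>u\<close>.\<close>

lemma minimal_length_generates:
  assumes N: "submodule N L M" and u: "u \<in> minimal_length_elements D \<sigma> V N"
  shows "generates_submodule L M u N"
proof (rule M.generates_submoduleI[OF N])
  show uN: "u \<in> N" using u by (simp add: minimal_length_iff)
  fix v assume v: "v \<in> N"
  note carr = M.submodule_carrier[OF N]
  obtain q r where qr: "q \<in> carrier L" "r \<in> carrier M" "v = q \<odot>\<^bsub>M\<^esub> u \<oplus>\<^bsub>M\<^esub> r" "r = \<zero>\<^bsub>M\<^esub> \<or> len r < len u"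
    using division[OF carr[OF uN] _ carr[OF v]] u by (auto simp: minimal_length_iff)
  have qu: "q \<odot>\<^bsub>M\<^esub> u \<in> N" using submodule.smult_closed[OF N qr(1) uN] .
  have "r = v \<ominus>\<^bsub>M\<^esub> q \<odot>\<^bsub>M\<^esub> u" using M.diff_eq_iff[OF carr[OF v] carr[OF qu] qr(2)] qr(3) by simp
  then have "r \<in> N" using M.submodule_diff[OF N v qu] by simp
  then have "r = \<zero>\<^bsub>M\<^esub>" using qr(4) u by (auto simp: minimal_length_iff not_less[symmetric])
  then show "\<exists>q\<in>carrier L. v = q \<odot>\<^bsub>M\<^esub> u" using qr carr[OF qu] by auto
qed

text \<open>If \<open>a\<close> kills a component of \<open>u\<close> but not \<open>u\<close>, then by minimality \<open>a\<close> does not kill the leading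
  component, so that \<open>b a u\<close> and \<open>u\<close> have the same leading component for some \<open>b\<close>.  By minimality
  again \<open>u = b a u\<close>, although this element has fewer nonzero components than \<open>u\<close>.\<close>

lemma minimal_length_annihilates:
  assumes N: "submodule N L M" and u: "u \<in> minimal_length_elements D \<sigma> V N"
    and a: "a \<in> carrier D" and i: "coord i u \<noteq> \<zero>\<^bsub>V\<^esub>" "P (- i) a \<odot>\<^bsub>V\<^esub> coord i u = \<zero>\<^bsub>V\<^esub>"
  shows "mon a 0 \<odot>\<^bsub>M\<^esub> u = \<zero>\<^bsub>M\<^esub>"
proof (rule ccontr)
  define w where "w = mon a 0 \<odot>\<^bsub>M\<^esub> u"
  assume "mon a 0 \<odot>\<^bsub>M\<^esub> u \<noteq> \<zero>\<^bsub>M\<^esub>"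
  then have w0: "w \<noteq> \<zero>\<^bsub>M\<^esub>" by (simp add: w_def)
  have uN: "u \<in> N" and u0: "u \<noteq> \<zero>\<^bsub>M\<^esub>" using u by (auto simp: minimal_length_iff)
  have uM: "u \<in> carrier M" using M.submodule_carrier[OF N uN] .
  have wN: "w \<in> N" using submodule.smult_closed[OF N mon_closed[OF a] uN] by (simp add: w_def)
  have wM: "w \<in> carrier M" using M.submodule_carrier[OF N wN] .
  obtain m n where s: "spans u m n" using spans_ex[OF uM u0] .
  have coord_w: "coord j w = P (- j) a \<odot>\<^bsub>V\<^esub> coord j u" for j
    using coord_smult_mon[OF a uM, of j 0] by (simp add: w_def)
  have z: "coord j u = \<zero>\<^bsub>V\<^esub>" "coord j w = \<zero>\<^bsub>V\<^esub>" if "j \<notin> {m..n}" for j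
    using s that a by (auto simp: spans_def coord_w V.smult_r_null)
  have "coord n w \<noteq> \<zero>\<^bsub>V\<^esub>"
  proof
    assume "coord n w = \<zero>\<^bsub>V\<^esub>"
    then have "coord j w = \<zero>\<^bsub>V\<^esub>" if "j < m \<or> n \<le> j" for j using z(2)[of j] that by (cases "j = n") auto
    then show False using minimal_length_shorter[OF N u s wN] w0 by blast
  qed
  then obtain b where b: "b \<in> carrier D" "coord n (u \<ominus>\<^bsub>M\<^esub> mon b (n - n) \<odot>\<^bsub>M\<^esub> w) = \<zero>\<^bsub>V\<^esub>"
    using cancel_leading[OF uM wM] by metis
  define y where "y = u \<ominus>\<^bsub>M\<^esub> mon b 0 \<odot>\<^bsub>M\<^esub> w"
  have bw: "mon b 0 \<odot>\<^bsub>M\<^esub> w \<in> N" using submodule.smult_closed[OF N mon_closed[OF b(1)] wN] .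
  have "y \<in> N" using M.submodule_diff[OF N uN bw] by (simp add: y_def)
  moreover have "coord j y = \<zero>\<^bsub>V\<^esub>" if "j < m \<or> n \<le> j" for j
  proof (cases "j = n")
    case True
    then show ?thesis using b by (simp add: y_def)
  next
    case False
    with that have "j \<notin> {m..n}" by auto
    then show ?thesis using uM wM b(1) z[of j]
      by (simp add: y_def coord_diff M.smult_closed coord_smult_mon V.smult_r_null V.M.minus_eq)
  qed
  ultimately have "y = \<zero>\<^bsub>M\<^esub>" using minimal_length_shorter[OF N u s] by blast
  then have "u = mon b 0 \<odot>\<^bsub>M\<^esub> w"
    using M.diff_eq_iff[OF uM M.submodule_carrier[OF N bw] M.M.zero_closed] M.submodule_carrier[OF N bw]
    by (simp add: y_def)
  then have "coord i u = P (- i) b \<odot>\<^bsub>V\<^esub> coord i w"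
    using coord_smult_mon[OF b(1) wM, of i 0] by simp
  then show False using i b(1) by (simp add: coord_w V.smult_r_null)
qed

text \<open>An element of degree 0 that kills \<open>u\<close> kills it coordinate by coordinate,
  hence kills each component. The converse, from a single nonzero component to all of
  \<open>u\<close>, is \<open>minimal_length_annihilates\<close>.\<close>

lemma minimal_length_uni_annihilators:
  assumes N: "submodule N L M"
  shows "minimal_length_elements D \<sigma> V N \<subseteq>
    uni_annihilators (laurent_grading D) M (laurent_module_grading D \<sigma> V)"
proof
  fix u assume u: "u \<in> minimal_length_elements D \<sigma> V N"
  then have uM: "u \<in> carrier M" using M.submodule_carrier[OF N] by (simp add: minimal_length_iff)
  have "annihilator_in (laurent_grading D 0) M u = annihilator_in (laurent_grading D 0) M (xt i (coord i u))"
    if "xt i (coord i u) \<noteq> \<zero>\<^bsub>M\<^esub>" for i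
  proof -
    have ci: "coord i u \<noteq> \<zero>\<^bsub>V\<^esub>" using that by auto
    have "mon a 0 \<odot>\<^bsub>M\<^esub> u = \<zero>\<^bsub>M\<^esub> \<longleftrightarrow> mon a 0 \<odot>\<^bsub>M\<^esub> xt i (coord i u) = \<zero>\<^bsub>M\<^esub>" if a: "a \<in> carrier D" for a
    proof -
      have "mon a 0 \<odot>\<^bsub>M\<^esub> xt i (coord i u) = \<zero>\<^bsub>M\<^esub> \<longleftrightarrow> P (- i) a \<odot>\<^bsub>V\<^esub> coord i u = \<zero>\<^bsub>V\<^esub>"
        using a uM by (auto simp: smult_mon_zero_iff coord_xt V.smult_r_null)
      also have "\<dots> \<longleftrightarrow> mon a 0 \<odot>\<^bsub>M\<^esub> u = \<zero>\<^bsub>M\<^esub>"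
        using minimal_length_annihilates[OF N u a ci] smult_mon_zero_iff[OF a uM] by blast
      finally show ?thesis by simp
    qed
    then show ?thesis by (auto simp: annihilator_in_def laurent_grading_def)
  qed
  then show "u \<in> uni_annihilators (laurent_grading D) M (laurent_module_grading D \<sigma> V)"
    using uM by (simp add: uni_annihilators_def homogeneous_component_eq)
qed

lemma submodule_principal:
  assumes N: "submodule N L M"
  shows "principal_submodule L M N"
proof (cases "N = {\<zero>\<^bsub>M\<^esub>}")
  \<comment> \<open>The zero submodule has no element of minimal length and is generated by zero
    instead.\<close>
  case True
  have "generates_submodule L M \<zero>\<^bsub>M\<^esub> N"
    by (rule M.generates_submoduleI[OF N]) (use True in \<open>auto intro!: bexI[of _ "\<zero>\<^bsub>L\<^esub>"] simp: M.smult_l_null\<close>)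
  then show ?thesis by (auto simp: principal_submodule_def)
next
  case False
  then show ?thesis
    using minimal_length_ex[OF N False] minimal_length_generates[OF N] by (auto simp: principal_submodule_def)
qed

end

theorem proposition3p3:
  fixes D :: "('a, 'm) ring_scheme"
    and \<sigma> :: "'a \<Rightarrow> 'a"
    and V :: "('a, 'b, 'n) module_scheme"
  assumes "ring D"
    and "\<sigma> \<in> ring_iso D D"
    and "simple_module D V"
  shows "euclidean_module (skew_laurent D \<sigma>) (laurent_module D \<sigma> V) (laurent_length D \<sigma> V)
    \<and> (\<forall>N. submodule N (skew_laurent D \<sigma>) (laurent_module D \<sigma> V) \<longrightarrow>
           principal_submodule (skew_laurent D \<sigma>) (laurent_module D \<sigma> V) N)
    \<and> (\<forall>N. submodule N (skew_laurent D \<sigma>) (laurent_module D \<sigma> V) \<and>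
             N \<noteq> {\<zero>\<^bsub>laurent_module D \<sigma> V\<^esub>} \<longrightarrow>
           minimal_length_elements D \<sigma> V N \<noteq> {} \<and>
           (\<forall>u \<in> minimal_length_elements D \<sigma> V N.
              generates_submodule (skew_laurent D \<sigma>) (laurent_module D \<sigma> V) u N) \<and>
           minimal_length_elements D \<sigma> V N \<subseteq>
             uni_annihilators (laurent_grading D) (laurent_module D \<sigma> V)
               (laurent_module_grading D \<sigma> V))"
proof -
  interpret ring D by fact
  interpret simple_module D V by fact
  interpret simple_induced_laurent D \<sigma> V
    by unfold_locales fact
  show ?thesis
    using euclidean submodule_principal minimal_length_ex minimal_length_generates
      minimal_length_uni_annihilators by blast
qed

end
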